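(* Let $X$ be a topological space, let $\varphi\colon X\to X$ be a homotopy equivalence, and let $F$ be the set of fixed points of $\varphi$. Let $f\colon X\to\mathbb{R}$ be a function which is bounded below, and let $b\in\mathbb{R}$ be such that $(f,\varphi)$ satisfies condition (D) on $f^b$. Then: (a) $$\sum_{d\le b}\operatorname{cat}_X\bigl(F\cap f^{-1}(d)\bigr)\ \ge\ \operatorname{cat}_X f^b .$$ (b) If $X$ is connected and weakly locally contractible, then $F\cap f^b$ is infinite or $f(F)\cap\,]-\infty,b]$ contains at least $\operatorname{cat}_X f^b$ elements. (c) If $X$ is a binormal ANR and $f(F)$ is discrete, then $$\operatorname{cat}\bigl(F\cap f^b\bigr)\ \ge\ \operatorname{cat}_X f^b .$$ If $\varphi$ is homotopic to the identity map, then (a), (b), (c) also hold for $b=\infty$ (in which case $f^b=X$, the condition $d\le b$ means $d\in\mathbb{R}$, and condition (D) is required on $X$).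
   Context: All spaces are Hausdorff, all maps and functions are continuous. $f^a=\{x\in X\mid f(x)\le a\}$. Lyapunov function: $f\colon X\to\mathbb{R}$ is a Lyapunov function for $\varphi\colon X\to X$ if $f(\varphi(x))<f(x)$ whenever $x$ is not a fixed point of $\varphi$. Condition (D): for $Y\subset X$, the pair $(f,\varphi)$ satisfies condition (D) on $Y$ if $f$ is a Lyapunov function for $\varphi$ and the following holds: if $A\subset Y$ is a subset on which $|f|$ is bounded but on which $f(y)-f(\varphi(y))$ is not bounded away from zero, then there is a fixed point of $\varphi$ in the closure of $A$. Category: for $A\subset X$, $\operatorname{cat}_X A$ is the minimal number of open subsets of $X$, each contractible in $X$ (i.e. with inclusion into $X$ homotopic to a constant map), which cover $A$ (so $\operatorname{cat}_X\emptyset=0$); if there is no finite such cover, $\operatorname{cat}_X A=\infty$. $\operatorname{cat}X=\operatorname{cat}_X X$; in particular $\operatorname{cat}(F\cap f^b)$ is the category of the space $F\cap f^b$ in itself. Conventions: $\infty\ge\infty$ and $\infty\ge n$ for all $n\in\mathbb{Z}$; a sum of values in $\{0,1,2,\dots,\infty\}$ is $\infty$ if some term is $\infty$ or infinitely many terms are nonzero. $X$ is weakly locally contractible if each point of $X$ has a neighborhood which is contractible in $X$. $X$ is binormal if $X\times[0,1]$ is normal. $X$ is an absolute neighborhood retract (ANR) if for each closed subset $Z$ of a normal space $Y$ every map $Z\to X$ admits an extension to a neighborhood of $Z$ in $Y$. *)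

theory Defs
  imports "HOL-Analysis.Analysis"
begin

definition neighbourhood_in :: "'a topology \<Rightarrow> 'a set \<Rightarrow> 'a set \<Rightarrow> bool" where
  "neighbourhood_in X S N \<longleftrightarrow> N \<subseteq> topspace X \<and> (\<exists>U. openin X U \<and> S \<subseteq> U \<and> U \<subseteq> N)"

definition contractible_in :: "'a topology \<Rightarrow> 'a set \<Rightarrow> bool" where
  "contractible_in X U \<longleftrightarrow> U \<subseteq> topspace X \<and>
     (\<exists>c\<in>topspace X. homotopic_with (\<lambda>h. True) (subtopology X U) X (\<lambda>x. x) (\<lambda>x. c))"

text \<open>The Lusternik--Schnirelmann category of \<open>A\<close> in \<open>X\<close>; the infimum of the empty set in
  \<^typ>\<open>enat\<close> is \<open>\<infinity>\<close>.\<close>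

definition cat_in :: "'a topology \<Rightarrow> 'a set \<Rightarrow> enat" where
  "cat_in X A = Inf {enat (card \<U>) | \<U>. finite \<U> \<and>
     (\<forall>U\<in>\<U>. openin X U \<and> contractible_in X U) \<and> A \<subseteq> \<Union>\<U>}"

definition cat_space :: "'a topology \<Rightarrow> enat" where
  "cat_space X = cat_in X (topspace X)"

definition esum :: "('i \<Rightarrow> enat) \<Rightarrow> 'i set \<Rightarrow> enat" where
  "esum g D = (if finite {d \<in> D. g d \<noteq> 0} then \<Sum>d\<in>{d \<in> D. g d \<noteq> 0}. g d else \<infinity>)"

definition ecard :: "'a set \<Rightarrow> enat" where
  "ecard S = (if finite S then enat (card S) else \<infinity>)"

definition fixed_points :: "'a topology \<Rightarrow> ('a \<Rightarrow> 'a) \<Rightarrow> 'a set" where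
  "fixed_points X \<phi> = {x \<in> topspace X. \<phi> x = x}"

text \<open>The level \<open>b\<close> is an extended real, so that \<open>b = \<infinity>\<close> gives the whole space.\<close>

definition sublevel :: "'a topology \<Rightarrow> ('a \<Rightarrow> real) \<Rightarrow> ereal \<Rightarrow> 'a set" where
  "sublevel X f b = {x \<in> topspace X. ereal (f x) \<le> b}"

definition homotopy_equivalence_map :: "'a topology \<Rightarrow> 'b topology \<Rightarrow> ('a \<Rightarrow> 'b) \<Rightarrow> bool" where
  "homotopy_equivalence_map X Y \<phi> \<longleftrightarrow> continuous_map X Y \<phi> \<and>
     (\<exists>\<psi>. continuous_map Y X \<psi> \<and>
          homotopic_with (\<lambda>h. True) X X (\<psi> \<circ> \<phi>) id \<and>
          homotopic_with (\<lambda>h. True) Y Y (\<phi> \<circ> \<psi>) id)"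

definition lyapunov_function :: "'a topology \<Rightarrow> ('a \<Rightarrow> real) \<Rightarrow> ('a \<Rightarrow> 'a) \<Rightarrow> bool" where
  "lyapunov_function X f \<phi> \<longleftrightarrow> continuous_map X euclideanreal f \<and>
     (\<forall>x\<in>topspace X. \<phi> x \<noteq> x \<longrightarrow> f (\<phi> x) < f x)"

definition condition_D :: "'a topology \<Rightarrow> ('a \<Rightarrow> real) \<Rightarrow> ('a \<Rightarrow> 'a) \<Rightarrow> 'a set \<Rightarrow> bool" where
  "condition_D X f \<phi> Y \<longleftrightarrow> lyapunov_function X f \<phi> \<and>
     (\<forall>A\<subseteq>Y. (\<exists>M. \<forall>y\<in>A. \<bar>f y\<bar> \<le> M) \<and>
             \<not> (\<exists>\<epsilon>>0. \<forall>y\<in>A. \<epsilon> \<le> \<bar>f y - f (\<phi> y)\<bar>) \<longrightarrow>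
             fixed_points X \<phi> \<inter> (X closure_of A) \<noteq> {})"

definition weakly_locally_contractible :: "'a topology \<Rightarrow> bool" where
  "weakly_locally_contractible X \<longleftrightarrow>
     (\<forall>x\<in>topspace X. \<exists>N. neighbourhood_in X {x} N \<and> contractible_in X N)"

definition binormal_space :: "'a topology \<Rightarrow> bool" where
  "binormal_space X \<longleftrightarrow> normal_space (prod_topology X (top_of_set {0..1::real}))"

text \<open>Absolute neighbourhood retract for the class of normal Hausdorff spaces. HOL cannot quantify
  over all types inside a formula, so the test spaces range over all topologies carried by
  subsets of a universe type \<open>'u\<close>, which is passed as a parameter.\<close>

definition ANR_space :: "'u itself \<Rightarrow> 'a topology \<Rightarrow> bool" where
  "ANR_space (u :: 'u itself) X \<longleftrightarrow>
     (\<forall>(Y :: 'u topology) Z g.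
        Hausdorff_space Y \<and> normal_space Y \<and> closedin Y Z \<and>
        continuous_map (subtopology Y Z) X g \<longrightarrow>
        (\<exists>N h. neighbourhood_in Y Z N \<and> continuous_map (subtopology Y N) X h \<and>
               (\<forall>z\<in>Z. h z = g z)))"

end

theory Submission
  imports Defs
begin

text \<open>
The theorem is Lusternik--Schnirelmann theory with the gradient flow replaced by the iterates of a
single map \<open>\<phi>\<close>. The category is subadditive and continuous, that is, a set has an open neighbourhood
of the same category. And it cannot drop under \<open>\<phi>\<close>: if \<open>\<phi>\<close> maps \<open>A\<close> into \<open>B\<close>, then the category of
\<open>A\<close> is at most that of \<open>B\<close>, since \<open>\<phi>\<close> has a homotopy inverse (\<open>cat_in_le_of_image\<close>).

Consider the sum over the levels up to a real \<open>b\<close>. Condition (D) gives uniform descent of \<open>f\<close> away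
from fixed points. So an iterate of \<open>\<phi>\<close> maps a sublevel set into any lower one if there are no fixed
points in between, and the category stays the same. At a level \<open>d\<close> with fixed points, all points near
that level but outside a neighbourhood of its fixed points are mapped below \<open>d\<close>, and the category
grows by at most that of the fixed points at level \<open>d\<close>. Summation over the critical values, if there
are finitely many, gives the claim (\<open>cat_sublevel_le_finite_sum\<close>).

For \<open>b = \<infinity>\<close> it remains to compare \<open>X\<close> with a sublevel set that contains all fixed points. Every point
is moved into it by some iterate, but not uniformly. A homotopy \<open>H\<close> from the identity to \<open>\<phi>\<close> makes
it possible to use noninteger times; the order of composition \<open>\<phi>\<^sup>n \<circ> H\<^sub>s\<close> is what keeps the height
under control (\<open>cat_space_le_cat_sublevel\<close>).

The other two estimates follow from this one. In a connected and weakly locally contractible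
Hausdorff space finite sets have category at most 1 (\<open>cat_in_finite_le_1\<close>), so the sum counts
critical values. If the critical values form a discrete set, a finite categorical cover of the fixed
point set splits into covers of the fixed points on the individual levels
(\<open>sum_cat_space_fibres_le\<close>); and these are closed subsets of \<open>X\<close>, for which the category in a
binormal ANR is at most the intrinsic category (\<open>cat_in_le_cat_space_closed_subspace\<close>).
\<close>

section \<open>Lusternik--Schnirelmann category of subsets\<close>

lemma contractible_in_subset:
  assumes "contractible_in X U" "V \<subseteq> U"
  shows "contractible_in X V"
proof -
  obtain c where c: "c \<in> topspace X"
    "homotopic_with (\<lambda>h. True) (subtopology X U) X (\<lambda>x. x) (\<lambda>x. c)"
    and U: "U \<subseteq> topspace X"
    using assms(1) unfolding contractible_in_def by blast
  have "continuous_map (subtopology X V) (subtopology X U) id"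
    using assms(2) by (auto simp: continuous_map_in_subtopology intro: continuous_map_from_subtopology)
  then have "homotopic_with (\<lambda>h. True) (subtopology X V) X ((\<lambda>x. x) \<circ> id) ((\<lambda>x. c) \<circ> id)"
    by (rule homotopic_with_compose_continuous_map_right[OF c(2)]) auto
  then show ?thesis
    using c(1) U assms(2) unfolding contractible_in_def by (auto simp: o_def)
qed

lemma cat_in_le:
  assumes "finite \<U>" "\<And>U. U \<in> \<U> \<Longrightarrow> openin X U \<and> contractible_in X U" "A \<subseteq> \<Union>\<U>"
  shows "cat_in X A \<le> enat (card \<U>)"
  unfolding cat_in_def by (rule Inf_lower) (use assms in blast)

lemma cat_in_cover:
  assumes "cat_in X A \<noteq> \<infinity>"
  obtains \<U> where "finite \<U>" "\<And>U. U \<in> \<U> \<Longrightarrow> openin X U \<and> contractible_in X U" "A \<subseteq> \<Union>\<U>"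
    "cat_in X A = enat (card \<U>)"
proof -
  let ?S = "{enat (card \<U>) | \<U>. finite \<U> \<and>
     (\<forall>U\<in>\<U>. openin X U \<and> contractible_in X U) \<and> A \<subseteq> \<Union>\<U>}"
  have ne: "?S \<noteq> {}"
  proof
    assume e: "?S = {}"
    have "cat_in X A = \<infinity>" unfolding cat_in_def e by (simp add: Inf_enat_def)
    then show False using assms by simp
  qed
  have "cat_in X A \<in> ?S"
    unfolding cat_in_def using wellorder_InfI[of _ ?S] ne by blast
  then show ?thesis using that by auto
qed

lemma cat_in_mono: "A \<subseteq> B \<Longrightarrow> cat_in X A \<le> cat_in X B"
  unfolding cat_in_def by (rule Inf_superset_mono) blast

lemma cat_in_empty: "cat_in X {} = 0"
  using cat_in_le[of "{}" X "{}"] by (simp flip: zero_enat_def)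

lemma cat_in_eq_0_iff: "cat_in X A = 0 \<longleftrightarrow> A = {}"
proof
  assume "cat_in X A = 0"
  moreover from this have "cat_in X A \<noteq> \<infinity>" by simp
  ultimately show "A = {}"
    by (metis cat_in_cover Sup_empty card_0_eq enat_0_iff(1) subset_empty)
qed (simp add: cat_in_empty)

lemma cat_in_Un: "cat_in X (A \<union> B) \<le> cat_in X A + cat_in X B"
proof (cases "cat_in X A = \<infinity> \<or> cat_in X B = \<infinity>")
  case False
  then obtain \<U> \<V> where U: "finite \<U>" "\<And>U. U \<in> \<U> \<Longrightarrow> openin X U \<and> contractible_in X U" "A \<subseteq> \<Union>\<U>"
    "cat_in X A = enat (card \<U>)" and
    V: "finite \<V>" "\<And>U. U \<in> \<V> \<Longrightarrow> openin X U \<and> contractible_in X U" "B \<subseteq> \<Union>\<V>"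
    "cat_in X B = enat (card \<V>)"
    by (metis cat_in_cover)
  have "cat_in X (A \<union> B) \<le> enat (card (\<U> \<union> \<V>))"
    by (rule cat_in_le) (use U V in auto)
  also have "\<dots> \<le> enat (card \<U> + card \<V>)" by (simp add: card_Un_le)
  finally show ?thesis using U V by simp
qed auto

text \<open>The category is defined by open covers, so a cover of \<open>A\<close> is also a cover of a neighbourhood of \<open>A\<close>.
This is what makes it possible to thicken the fixed points at a level before deforming the rest
of the sublevel set away from them.\<close>

lemma cat_in_open_nbhd:
  assumes "A \<subseteq> topspace X"
  obtains U where "openin X U" "A \<subseteq> U" "cat_in X U \<le> cat_in X A"
proof (cases "cat_in X A = \<infinity>")
  case True
  then show ?thesis using that[of "topspace X"] assms by simp
next
  case False
  then obtain \<U> where "finite \<U>" "\<And>U. U \<in> \<U> \<Longrightarrow> openin X U \<and> contractible_in X U" "A \<subseteq> \<Union>\<U>"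
    "cat_in X A = enat (card \<U>)" by (metis cat_in_cover)
  then show ?thesis using that[of "\<Union>\<U>"] cat_in_le[of \<U> X "\<Union>\<U>"] by auto
qed

text \<open>A left inverse up to homotopy is what lets null-homotopies be pulled back along \<open>g\<close>. Homotopy
equivalences have one, and for a map homotopic to the identity the identity is one.\<close>

definition homotopy_left_invertible :: "'a topology \<Rightarrow> ('a \<Rightarrow> 'a) \<Rightarrow> bool" where
  "homotopy_left_invertible X g \<longleftrightarrow> continuous_map X X g \<and>
     (\<exists>\<psi>. continuous_map X X \<psi> \<and> homotopic_with (\<lambda>h. True) X X (\<psi> \<circ> g) id)"

text \<open>A set that a homotopy left invertible map \<open>g\<close> sends into a set contractible in \<open>X\<close> is itself
contractible in \<open>X\<close>: if \<open>\<psi>\<close> is a left inverse, its inclusion is homotopic to \<open>\<psi> \<circ> g\<close>, which is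
null-homotopic. Hence preimages of a cover of \<open>B\<close> give a cover of \<open>A\<close>.\<close>

lemma cat_in_le_of_image:
  assumes g: "homotopy_left_invertible X g" and A: "A \<subseteq> topspace X" "g ` A \<subseteq> B"
  shows "cat_in X A \<le> cat_in X B"
proof (cases "cat_in X B = \<infinity>")
  case False
  then obtain \<U> where U: "finite \<U>" "\<And>U. U \<in> \<U> \<Longrightarrow> openin X U \<and> contractible_in X U" "B \<subseteq> \<Union>\<U>"
    "cat_in X B = enat (card \<U>)" by (metis cat_in_cover)
  obtain \<psi> where cg: "continuous_map X X g" and cp: "continuous_map X X \<psi>"
    and pg: "homotopic_with (\<lambda>h. True) X X (\<psi> \<circ> g) id"
    using g unfolding homotopy_left_invertible_def by blast
  define P where "P U = {x \<in> topspace X. g x \<in> U}" for U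
  have "contractible_in X (P U)" if "U \<in> \<U>" for U
  proof -
    have "contractible_in X U" using U(2) that by blast
    then obtain c where c: "c \<in> topspace X"
      "homotopic_with (\<lambda>h. True) (subtopology X U) X (\<lambda>x. x) (\<lambda>x. c)"
      unfolding contractible_in_def by blast
    have "continuous_map (subtopology X (P U)) (subtopology X U) g"
      using cg by (auto simp: continuous_map_in_subtopology continuous_map_from_subtopology P_def)
    then have "homotopic_with (\<lambda>h. True) (subtopology X (P U)) X ((\<lambda>x. x) \<circ> g) ((\<lambda>x. c) \<circ> g)"
      by (rule homotopic_with_compose_continuous_map_right[OF c(2)]) auto
    then have "homotopic_with (\<lambda>h. True) (subtopology X (P U)) X
        (\<psi> \<circ> ((\<lambda>x. x) \<circ> g)) (\<psi> \<circ> ((\<lambda>x. c) \<circ> g))"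
      by (rule homotopic_with_compose_continuous_map_left[OF _ cp]) auto
    moreover have "homotopic_with (\<lambda>h. True) (subtopology X (P U)) X id (\<psi> \<circ> g)"
      using homotopic_with_compose_continuous_map_right[OF pg, of "subtopology X (P U)" id]
      by (simp add: homotopic_with_sym)
    ultimately have "homotopic_with (\<lambda>h. True) (subtopology X (P U)) X (\<lambda>x. x) (\<lambda>x. \<psi> c)"
      using homotopic_with_trans by (force simp: o_def id_def)
    moreover have "\<psi> c \<in> topspace X"
      using cp c(1) by (meson continuous_map_image_subset_topspace image_subset_iff)
    ultimately show ?thesis unfolding contractible_in_def P_def by blast
  qed
  moreover have "openin X (P U)" if "U \<in> \<U>" for U
    unfolding P_def using openin_continuous_map_preimage cg U(2) that by blast
  ultimately have "cat_in X A \<le> enat (card (P ` \<U>))"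
  proof (intro cat_in_le)
    show "A \<subseteq> \<Union>(P ` \<U>)" using U(3) A unfolding P_def by blast
  qed (use U(1) in auto)
  also have "\<dots> \<le> enat (card \<U>)" using U(1) by (simp add: card_image_le)
  finally show ?thesis using U by simp
qed simp

lemma cat_in_le_of_iterate_image:
  assumes g: "homotopy_left_invertible X g" and A: "A \<subseteq> topspace X" "(g ^^ n) ` A \<subseteq> B"
  shows "cat_in X A \<le> cat_in X B"
  using A
proof (induction n arbitrary: A)
  case 0
  then show ?case by (simp add: cat_in_mono)
next
  case (Suc n)
  have "g ` A \<subseteq> topspace X"
    using g Suc.prems(1) continuous_map_image_subset_topspace
    unfolding homotopy_left_invertible_def by blast
  moreover have "(g ^^ n) ` (g ` A) \<subseteq> B"
    using Suc.prems(2) by (simp add: image_comp funpow_Suc_right del: funpow.simps)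
  ultimately have "cat_in X (g ` A) \<le> cat_in X B" by (rule Suc.IH)
  with cat_in_le_of_image[OF g Suc.prems(1)] show ?case by (meson order.refl order.trans)
qed

section \<open>Descent along a Lyapunov function\<close>

locale lyapunov_pair =
  fixes X :: "'a topology" and \<phi> :: "'a \<Rightarrow> 'a" and f :: "'a \<Rightarrow> real" and b :: ereal
  assumes cont_\<phi>: "continuous_map X X \<phi>"
    and D: "condition_D X f \<phi> (sublevel X f b)"
begin

abbreviation F :: "'a set" where "F \<equiv> fixed_points X \<phi>"

abbreviation S :: "real \<Rightarrow> 'a set" where "S c \<equiv> sublevel X f (ereal c)"

lemma cont_f: "continuous_map X euclideanreal f"
  using D unfolding condition_D_def lyapunov_function_def by blast

lemma \<phi>_in: "x \<in> topspace X \<Longrightarrow> \<phi> x \<in> topspace X"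
  using cont_\<phi> by (simp add: continuous_map_def Pi_iff)

lemma iterate_in: "x \<in> topspace X \<Longrightarrow> (\<phi> ^^ n) x \<in> topspace X"
  by (induction n) (auto simp: \<phi>_in)

lemma f_\<phi>_le: "x \<in> topspace X \<Longrightarrow> f (\<phi> x) \<le> f x"
  using D unfolding condition_D_def lyapunov_function_def by (metis less_imp_le order.refl)

lemma f_iterate_antimono:
  assumes "x \<in> topspace X" "m \<le> n"
  shows "f ((\<phi> ^^ n) x) \<le> f ((\<phi> ^^ m) x)"
  using assms(2)
proof (induction rule: dec_induct)
  case (step n)
  then show ?case using f_\<phi>_le[OF iterate_in[OF assms(1)], of n] by simp
qed simp

text \<open>Condition (D) read positively: away from the fixed points, one step of \<open>\<phi>\<close> lowers \<open>f\<close> by a fixed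
amount, as long as the values of \<open>f\<close> stay bounded. It replaces the compactness that the classical
deformation lemma relies on.\<close>

lemma uniform_descent:
  assumes A: "A \<subseteq> sublevel X f b" and bdd: "\<And>x. x \<in> A \<Longrightarrow> l \<le> f x \<and> f x \<le> u"
    and noF: "F \<inter> (X closure_of A) = {}"
  obtains \<epsilon> where "\<epsilon> > 0" "\<And>x. x \<in> A \<Longrightarrow> f (\<phi> x) \<le> f x - \<epsilon>"
proof -
  have "\<forall>y\<in>A. \<bar>f y\<bar> \<le> max \<bar>l\<bar> \<bar>u\<bar>" using bdd by fastforce
  then obtain \<epsilon> where "\<epsilon> > 0" "\<forall>y\<in>A. \<epsilon> \<le> \<bar>f y - f (\<phi> y)\<bar>"
    using D A noF unfolding condition_D_def by meson
  moreover have "x \<in> topspace X" if "x \<in> A" for x using A that by (auto simp: sublevel_def)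
  ultimately show ?thesis
    using that[of \<epsilon>] f_\<phi>_le by (smt (verit, best))
qed

lemma closedin_band:
  "closedin X {x \<in> topspace X. l \<le> f x \<and> f x \<le> u}"
proof -
  have "{x \<in> topspace X. l \<le> f x \<and> f x \<le> u} = {x \<in> topspace X. f x \<in> {l..u}}" by auto
  then show ?thesis
    using closedin_continuous_map_preimage[OF cont_f, of "{l..u}"] by simp
qed

lemma closedin_sublevel: "closedin X (sublevel X f b)"
proof (cases b)
  case (real r)
  have "sublevel X f b = {x \<in> topspace X. f x \<in> {..r}}" using real by (auto simp: sublevel_def)
  then show ?thesis
    using closedin_continuous_map_preimage[OF cont_f, of "{..r}"] by simp
qed (auto simp: sublevel_def)

text \<open>By uniform descent, finitely many steps cross a band without critical values. The number of steps is
the same for all points, so a single iterate of \<open>\<phi>\<close> does it.\<close>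

lemma push_through_regular_band:
  assumes ub: "ereal u \<le> b" and reg: "\<And>x. x \<in> F \<Longrightarrow> \<not> (l \<le> f x \<and> f x \<le> u)"
  obtains n where "(\<phi> ^^ n) ` S u \<subseteq> S l"
proof -
  define A where "A = {x \<in> topspace X. l \<le> f x \<and> f x \<le> u}"
  have "X closure_of A = A"
    using closedin_band unfolding A_def by (simp add: closure_of_closedin)
  then have noF: "F \<inter> (X closure_of A) = {}" using reg by (auto simp: A_def)
  have AS: "A \<subseteq> sublevel X f b"
    using ub by (auto simp: A_def sublevel_def intro: order_trans[of _ "ereal u"])
  have "l \<le> f x \<and> f x \<le> u" if "x \<in> A" for x using that by (simp add: A_def)
  from uniform_descent[OF AS this noF]
  obtain \<epsilon> where \<epsilon>: "\<epsilon> > 0" "\<And>x. x \<in> A \<Longrightarrow> f (\<phi> x) \<le> f x - \<epsilon>"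
    by blast
  have step: "f ((\<phi> ^^ n) x) \<le> max l (u - n * \<epsilon>)" if x: "x \<in> S u" for n x
  proof (induction n)
    case 0
    then show ?case using x by (simp add: sublevel_def max.coboundedI2)
  next
    case (Suc n)
    let ?y = "(\<phi> ^^ n) x"
    have y: "?y \<in> topspace X" using x iterate_in by (simp add: sublevel_def)
    have yu: "f ?y \<le> u"
      using f_iterate_antimono[of x 0 n] x by (simp add: sublevel_def)
    show ?case
    proof (cases "l \<le> f ?y")
      case True
      then have "f (\<phi> ?y) \<le> f ?y - \<epsilon>" using y yu by (intro \<epsilon>(2)) (simp add: A_def)
      then show ?thesis using Suc \<epsilon>(1) by (simp add: algebra_simps max_def split: if_splits)
    next
      case False
      then show ?thesis using f_\<phi>_le[OF y] by simp
    qed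
  qed
  obtain n :: nat where "real n > (u - l) / \<epsilon>" using reals_Archimedean2 by blast
  then have "u - n * \<epsilon> \<le> l" using \<epsilon>(1) by (simp add: field_simps)
  then have "f ((\<phi> ^^ n) x) \<le> l" if "x \<in> S u" for x using step[OF that, of n] by simp
  then have "(\<phi> ^^ n) ` S u \<subseteq> S l"
    using iterate_in by (auto simp: sublevel_def)
  then show ?thesis using that by blast
qed

text \<open>Near a critical value only the points outside a neighbourhood of the fixed points descend uniformly,
say by \<open>\<delta>\<close>. If the band around \<open>d\<close> has half-width at most \<open>\<delta> / 2\<close>, one single step takes these points
below the band. Using a single step avoids having to control points that \<open>\<phi>\<close> moves back into the
neighbourhood.\<close>

lemma push_past_critical_level:
  assumes U: "openin X U" "F \<inter> f -` {d} \<subseteq> U" and \<epsilon>0: "\<epsilon>0 > 0"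
    and iso: "\<And>x. x \<in> F \<inter> sublevel X f b \<Longrightarrow> \<bar>f x - d\<bar> \<le> \<epsilon>0 \<Longrightarrow> f x = d"
  obtains \<epsilon> where "\<epsilon> > 0" "\<epsilon> \<le> \<epsilon>0"
    "\<And>x. x \<in> sublevel X f b \<Longrightarrow> f x \<le> d + \<epsilon> \<Longrightarrow> x \<notin> U \<Longrightarrow> f (\<phi> x) \<le> d - \<epsilon>"
proof -
  define B where
    "B = ({x \<in> topspace X. d - \<epsilon>0 \<le> f x \<and> f x \<le> d + \<epsilon>0} - U) \<inter> sublevel X f b"
  have "X closure_of B = B"
    unfolding B_def using closedin_band closedin_sublevel U(1)
    by (simp add: closure_of_closedin closedin_diff closedin_Int)
  moreover have "F \<inter> B = {}" using U(2) iso by (fastforce simp: B_def abs_le_iff)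
  ultimately have noF: "F \<inter> X closure_of B = {}" by simp
  have AS: "B \<subseteq> sublevel X f b" by (simp add: B_def)
  have "d - \<epsilon>0 \<le> f x \<and> f x \<le> d + \<epsilon>0" if "x \<in> B" for x using that by (simp add: B_def)
  from uniform_descent[OF AS this noF]
  obtain \<delta> where \<delta>: "\<delta> > 0" "\<And>x. x \<in> B \<Longrightarrow> f (\<phi> x) \<le> f x - \<delta>"
    by blast
  show ?thesis
  proof (rule that[of "min \<epsilon>0 (\<delta> / 2)"])
    fix x assume x: "x \<in> sublevel X f b" "f x \<le> d + min \<epsilon>0 (\<delta> / 2)" "x \<notin> U"
    then have xX: "x \<in> topspace X" by (simp add: sublevel_def)
    show "f (\<phi> x) \<le> d - min \<epsilon>0 (\<delta> / 2)"
    proof (cases "d - min \<epsilon>0 (\<delta> / 2) \<le> f x")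
      case True
      then have "x \<in> B" using x xX by (auto simp: B_def)
      from \<delta>(2)[OF this] show ?thesis using x(2) by linarith
    next
      case False
      then show ?thesis using f_\<phi>_le[OF xX] by linarith
    qed
  qed (use \<epsilon>0 \<delta>(1) in auto)
qed

text \<open>The induction is on the number of critical values up to \<open>c\<close>. Passing the highest one, \<open>d\<close>, costs the
category of a neighbourhood of the fixed points at level \<open>d\<close>, by subadditivity; what remains is
pushed below \<open>d\<close>. Below the lowest critical value, the lower bound of \<open>f\<close> lets everything be
pushed into the empty set.\<close>

lemma cat_sublevel_le_finite_sum:
  assumes inv: "homotopy_left_invertible X \<phi>" and bdd: "bdd_below (f ` topspace X)"
    and fin: "finite (f ` F \<inter> {d. ereal d \<le> b})" and cb: "ereal c \<le> b"
  shows "cat_in X (S c) \<le> (\<Sum>d \<in> f ` F \<inter> {..c}. cat_in X (F \<inter> f -` {d}))"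
  using cb
proof (induction "card (f ` F \<inter> {..c})" arbitrary: c rule: less_induct)
  case less
  let ?K = "\<lambda>c. f ` F \<inter> {..c}"
  have sub: "?K c' \<subseteq> f ` F \<inter> {d. ereal d \<le> b}" if "c' \<le> c" for c'
    using that less.prems by (auto intro: order_trans[of _ "ereal c"])
  then have fc: "finite (?K c)" using fin finite_subset by blast
  have regular: "cat_in X (S u) \<le> cat_in X (S l)"
    if "ereal u \<le> b" "\<And>x. x \<in> F \<Longrightarrow> \<not> (l \<le> f x \<and> f x \<le> u)" for l u
  proof -
    from push_through_regular_band[OF that] obtain n where "(\<phi> ^^ n) ` S u \<subseteq> S l"
      by blast
    then show ?thesis
      by (intro cat_in_le_of_iterate_image[OF inv]) (auto simp: sublevel_def)
  qed
  show ?case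
  proof (cases "?K c = {}")
    case True
    obtain m where m: "\<And>x. x \<in> topspace X \<Longrightarrow> m \<le> f x"
      using bdd unfolding bdd_below_def by auto
    have "cat_in X (S c) \<le> cat_in X (S (m - 1))"
      using less.prems True by (intro regular) auto
    also have "S (m - 1) = {}" using m by (force simp: sublevel_def)
    finally show ?thesis by (simp add: cat_in_empty)
  next
    case False
    define d where "d = Max (?K c)"
    have d: "d \<in> ?K c" "\<And>d'. d' \<in> ?K c \<Longrightarrow> d' \<le> d"
      using Max_in[OF fc False] Max_ge[OF fc] by (auto simp: d_def)
    obtain U where U: "openin X U" "F \<inter> f -` {d} \<subseteq> U"
      "cat_in X U \<le> cat_in X (F \<inter> f -` {d})"
      using cat_in_open_nbhd[of "F \<inter> f -` {d}" X] by (auto simp: fixed_points_def)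
    obtain \<rho> where \<rho>: "\<rho> > 0" "\<And>d'. d' \<in> f ` F \<inter> {d. ereal d \<le> b} \<Longrightarrow> d' \<noteq> d \<Longrightarrow> \<rho> \<le> dist d d'"
      using finite_set_avoid[OF fin, of d] by auto
    have "f x = d" if "x \<in> F \<inter> sublevel X f b" "\<bar>f x - d\<bar> \<le> \<rho> / 2" for x
    proof (rule ccontr)
      assume "f x \<noteq> d"
      moreover have "f x \<in> f ` F \<inter> {d. ereal d \<le> b}" using that(1) by (auto simp: sublevel_def)
      ultimately have "\<rho> \<le> dist d (f x)" by (intro \<rho>(2))
      then have "\<rho> \<le> \<bar>f x - d\<bar>" by (simp add: dist_real_def)
      then show False using that(2) \<rho>(1) by linarith
    qed
    then obtain \<epsilon> where \<epsilon>: "\<epsilon> > 0"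
      "\<And>x. x \<in> sublevel X f b \<Longrightarrow> f x \<le> d + \<epsilon> \<Longrightarrow> x \<notin> U \<Longrightarrow> f (\<phi> x) \<le> d - \<epsilon>"
      using push_past_critical_level[OF U(1,2), of "\<rho> / 2"] \<rho>(1) by (metis half_gt_zero)
    \<comment> \<open>The band above \<open>d\<close> must not leave the sublevel set of \<open>c\<close>, as nothing is known about \<open>\<phi>\<close> above
      level \<open>b\<close>; this matters when \<open>d = c = b\<close>.\<close>
    define e where "e = min c (d + \<epsilon>)"
    have "ereal e \<le> ereal c" by (simp add: e_def)
    then have eb: "ereal e \<le> b" using less.prems by (rule order_trans)
    have "cat_in X (S c) \<le> cat_in X (S e)"
    proof (cases "c \<le> d + \<epsilon>")
      case True
      then show ?thesis by (simp add: e_def)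
    next
      case False
      have "f x \<le> d" if "x \<in> F" "f x \<le> c" for x using d(2) that by auto
      then show ?thesis
        using False \<epsilon>(1) less.prems by (intro regular) (fastforce simp: e_def)+
    qed
    also have "\<dots> \<le> cat_in X (U \<union> (S e - U))"
      by (rule cat_in_mono) blast
    also have "\<dots> \<le> cat_in X U + cat_in X (S e - U)" by (rule cat_in_Un)
    also have "\<dots> \<le> cat_in X (F \<inter> f -` {d}) + (\<Sum>d \<in> ?K (d - \<epsilon>). cat_in X (F \<inter> f -` {d}))"
    proof (rule add_mono[OF U(3)])
      have "\<phi> x \<in> S (d - \<epsilon>)" if x: "x \<in> S e - U" for x
      proof -
        have "x \<in> sublevel X f b"
          using x eb by (auto simp: sublevel_def intro: order_trans[of _ "ereal e"])
        moreover have "f x \<le> d + \<epsilon>" using x by (simp add: sublevel_def e_def)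
        ultimately show ?thesis using \<epsilon>(2) x \<phi>_in by (simp add: sublevel_def)
      qed
      then have "cat_in X (S e - U) \<le> cat_in X (S (d - \<epsilon>))"
        by (intro cat_in_le_of_image[OF inv]) (auto simp: sublevel_def)
      also have "\<dots> \<le> (\<Sum>d \<in> ?K (d - \<epsilon>). cat_in X (F \<inter> f -` {d}))"
      proof (rule less.hyps)
        have "d \<notin> ?K (d - \<epsilon>)" "?K (d - \<epsilon>) \<subseteq> ?K c" using d(1) \<epsilon>(1) by auto
        then have "?K (d - \<epsilon>) \<subset> ?K c" using d(1) by blast
        then show "card (?K (d - \<epsilon>)) < card (?K c)" by (rule psubset_card_mono[OF fc])
        show "ereal (d - \<epsilon>) \<le> b"
          using d(1) \<epsilon>(1) less.prems by (auto intro: order_trans[of _ "ereal c"])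
      qed
      finally show "cat_in X (S e - U) \<le> (\<Sum>d \<in> ?K (d - \<epsilon>). cat_in X (F \<inter> f -` {d}))" .
    qed
    also have "\<dots> = (\<Sum>d \<in> insert d (?K (d - \<epsilon>)). cat_in X (F \<inter> f -` {d}))"
    proof (rule sum.insert[symmetric])
      have "?K (d - \<epsilon>) \<subseteq> ?K c" using d(1) \<epsilon>(1) by auto
      then show "finite (?K (d - \<epsilon>))" using fc by (rule finite_subset)
    qed (use \<epsilon>(1) in auto)
    also have "\<dots> \<le> (\<Sum>d \<in> ?K c. cat_in X (F \<inter> f -` {d}))"
      using d(1) \<epsilon>(1) by (intro sum_mono2[OF fc]) auto
    finally show ?thesis .
  qed
qed

end

section \<open>Levels above all fixed points\<close>

lemma continuous_map_slice:
  assumes "continuous_map (prod_topology K Y) Z h" "y \<in> topspace Y"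
  shows "continuous_map K Z (\<lambda>t. h (t, y))"
  using continuous_map_compose[OF _ assms(1), of K "\<lambda>t. (t, y)"] assms(2)
  by (simp add: o_def continuous_map_pairedI)

text \<open>The two semicontinuities come from the projection \<open>K \<times> X \<rightarrow> X\<close>: it is open, and it is closed because
\<open>K\<close> is compact.\<close>

lemma continuous_map_SUP_compact:
  fixes h :: "'k \<times> 'a \<Rightarrow> real"
  assumes K: "compact_space K" "topspace K \<noteq> {}"
    and h: "continuous_map (prod_topology K X) euclideanreal h"
  shows "continuous_map X euclideanreal (\<lambda>x. SUP k\<in>topspace K. h (k, x))"
    and "\<And>x k. \<lbrakk>x \<in> topspace X; k \<in> topspace K\<rbrakk> \<Longrightarrow> h (k, x) \<le> (SUP k\<in>topspace K. h (k, x))"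
proof -
  define m where "m x = (SUP k\<in>topspace K. h (k, x))" for x
  have att: "\<exists>k\<in>topspace K. h (k, x) = m x \<and> (\<forall>k'\<in>topspace K. h (k', x) \<le> m x)"
    if x: "x \<in> topspace X" for x
  proof -
    have "continuous_map K euclideanreal (\<lambda>k. h (k, x))"
      by (rule continuous_map_slice[OF h x])
    then have "compactin euclideanreal ((\<lambda>k. h (k, x)) ` topspace K)"
      using image_compactin K(1) unfolding compact_space_def by blast
    then have "compact ((\<lambda>k. h (k, x)) ` topspace K)" by simp
    from compact_attains_sup[OF this] K(2)
    obtain k where k: "k \<in> topspace K" "\<forall>k'\<in>topspace K. h (k', x) \<le> h (k, x)" by auto
    moreover have "m x = h (k, x)"
      unfolding m_def using k by (intro cSup_eq_maximum) auto
    ultimately show ?thesis by auto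
  qed
  have "openin X {x \<in> topspace X. a < m x}" for a
  proof -
    have "openin (prod_topology K X) {p \<in> topspace (prod_topology K X). h p \<in> {a<..}}"
      by (rule openin_continuous_map_preimage[OF h]) simp
    then have "openin X (snd ` {p \<in> topspace (prod_topology K X). h p \<in> {a<..}})"
      using open_map_snd unfolding open_map_def by blast
    moreover have "snd ` {p \<in> topspace (prod_topology K X). h p \<in> {a<..}} = {x \<in> topspace X. a < m x}"
    proof (intro equalityI subsetI)
      fix x assume "x \<in> snd ` {p \<in> topspace (prod_topology K X). h p \<in> {a<..}}"
      then obtain k where "k \<in> topspace K" "x \<in> topspace X" "h (k, x) \<in> {a<..}" by auto
      then show "x \<in> {x \<in> topspace X. a < m x}" using att[of x] by fastforce
    next
      fix x assume x: "x \<in> {x \<in> topspace X. a < m x}"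
      then obtain k where "k \<in> topspace K" "h (k, x) = m x" using att[of x] by auto
      then have "(k, x) \<in> {p \<in> topspace (prod_topology K X). h p \<in> {a<..}}" using x by simp
      then show "x \<in> snd ` {p \<in> topspace (prod_topology K X). h p \<in> {a<..}}" by (rule image_eqI[rotated]) simp
    qed
    ultimately show ?thesis by simp
  qed
  moreover have "openin X {x \<in> topspace X. m x < a}" for a
  proof -
    have "closedin (prod_topology K X) {p \<in> topspace (prod_topology K X). h p \<in> {a..}}"
      by (rule closedin_continuous_map_preimage[OF h]) simp
    then have "closedin X (snd ` {p \<in> topspace (prod_topology K X). h p \<in> {a..}})"
      using closed_map_snd[OF K(1)] unfolding closed_map_def by blast
    moreover have "snd ` {p \<in> topspace (prod_topology K X). h p \<in> {a..}} = {x \<in> topspace X. a \<le> m x}"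
    proof (intro equalityI subsetI)
      fix x assume "x \<in> snd ` {p \<in> topspace (prod_topology K X). h p \<in> {a..}}"
      then obtain k where "k \<in> topspace K" "x \<in> topspace X" "h (k, x) \<in> {a..}" by auto
      then show "x \<in> {x \<in> topspace X. a \<le> m x}" using att[of x] by fastforce
    next
      fix x assume x: "x \<in> {x \<in> topspace X. a \<le> m x}"
      then obtain k where "k \<in> topspace K" "h (k, x) = m x" using att[of x] by auto
      then have "(k, x) \<in> {p \<in> topspace (prod_topology K X). h p \<in> {a..}}" using x by simp
      then show "x \<in> snd ` {p \<in> topspace (prod_topology K X). h p \<in> {a..}}" by (rule image_eqI[rotated]) simp
    qed
    ultimately have "openin X (topspace X - {x \<in> topspace X. a \<le> m x})" by auto
    moreover have "topspace X - {x \<in> topspace X. a \<le> m x} = {x \<in> topspace X. m x < a}" by auto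
    ultimately show ?thesis by simp
  qed
  ultimately show "continuous_map X euclideanreal (\<lambda>x. SUP k\<in>topspace K. h (k, x))"
    unfolding continuous_map_upper_lower_semicontinuous_lt m_def by blast
  show "\<And>x k. \<lbrakk>x \<in> topspace X; k \<in> topspace K\<rbrakk> \<Longrightarrow> h (k, x) \<le> (SUP k\<in>topspace K. h (k, x))"
    using att by (auto simp: m_def)
qed

text \<open>The bound \<open>N k\<close> depends on the integer level \<open>k\<close>; a stopping time has to be a continuous function
of the level.\<close>

lemma continuous_majorant:
  fixes N :: "nat \<Rightarrow> nat"
  obtains \<tau> :: "real \<Rightarrow> real" where "continuous_on UNIV \<tau>" "\<And>r. \<tau> r \<ge> 0"
    "\<And>r. \<exists>k. r \<le> real k \<and> real (N k) \<le> \<tau> r"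
proof -
  \<comment> \<open>The summand \<open>t j\<close> vanishes for \<open>r \<le> j - 2\<close>, so the sum is locally finite, and is at least \<open>N j\<close>
    for \<open>r \<ge> j - 1\<close>.\<close>
  define t where "t j r = real (N j) * max 0 (r - real j + 2)" for j r
  define \<tau> where "\<tau> r = real (N 0) + (\<Sum>j < nat \<lceil>r\<rceil> + 2. t j r)" for r
  have t0: "t j r \<ge> 0" for j r by (simp add: t_def)
  have eq: "\<tau> r = real (N 0) + (\<Sum>j < n + 2. t j r)" if "r < real n" for r n
  proof -
    have "(\<Sum>j < nat \<lceil>r\<rceil> + 2. t j r) = (\<Sum>j < n + 2. t j r)"
    proof (rule sum.mono_neutral_left)
      show "{..<nat \<lceil>r\<rceil> + 2} \<subseteq> {..<n + 2}" using that by (simp add: nat_le_iff ceiling_le_iff)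
      show "\<forall>i\<in>{..<n + 2} - {..<nat \<lceil>r\<rceil> + 2}. t i r = 0"
      proof
        fix i assume i: "i \<in> {..<n + 2} - {..<nat \<lceil>r\<rceil> + 2}"
        have "real (nat \<lceil>r\<rceil> + 2) \<le> real i" using i by (simp only: of_nat_le_iff) simp
        then have "r - real i + 2 \<le> 0" using real_nat_ceiling_ge[of r] by simp
        then show "t i r = 0" by (simp add: t_def)
      qed
    qed simp
    then show ?thesis by (simp add: \<tau>_def)
  qed
  have "continuous_on (\<Union>n::nat. {..<real n}) \<tau>"
  proof (rule continuous_on_open_UN)
    fix n :: nat
    have "continuous_on {..<real n} (\<lambda>r. real (N 0) + (\<Sum>j < n + 2. t j r))"
      unfolding t_def by (intro continuous_intros)
    then show "continuous_on {..<real n} \<tau>"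
      by (rule continuous_on_cong[THEN iffD1, rotated -1]) (simp_all add: eq)
  qed auto
  moreover have "(\<Union>n::nat. {..<real n}) = UNIV" using reals_Archimedean2 by auto
  moreover have "\<tau> r \<ge> 0" for r by (simp add: \<tau>_def t0 sum_nonneg)
  moreover have "\<exists>k. r \<le> real k \<and> real (N k) \<le> \<tau> r" for r
  proof (intro exI conjI)
    show "r \<le> real (nat \<lceil>r\<rceil>)" by (rule real_nat_ceiling_ge)
    show "real (N (nat \<lceil>r\<rceil>)) \<le> \<tau> r"
    proof (cases "r \<le> 0")
      case True
      then have "nat \<lceil>r\<rceil> = 0" by simp
      then show ?thesis by (simp add: \<tau>_def t0 sum_nonneg del: nat_eq_iff)
    next
      case False
      then have "1 \<le> max 0 (r - real (nat \<lceil>r\<rceil>) + 2)" by linarith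
      then have "real (N (nat \<lceil>r\<rceil>)) \<le> t (nat \<lceil>r\<rceil>) r"
        unfolding t_def using mult_left_mono[of 1 _ "real (N (nat \<lceil>r\<rceil>))"] by (metis mult.right_neutral of_nat_0_le_iff)
      also have "\<dots> \<le> (\<Sum>j < nat \<lceil>r\<rceil> + 2. t j r)" by (intro member_le_sum) (auto simp: t0)
      finally show ?thesis by (simp add: \<tau>_def)
    qed
  qed
  ultimately show ?thesis using that by metis
qed

text \<open>If \<open>H\<close> is a homotopy from the identity to \<open>\<phi>\<close>, this is the homotopy \<open>t \<mapsto> \<phi>\<^sup>n \<circ> H\<^sub>s\<close>, where \<open>t = n + s\<close>,
for times \<open>t \<le> M\<close>. As a composition of the maps \<open>H\<close> at the times \<open>t, t - 1, t - 2, \<dots>\<close> cut off to the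
unit interval, it needs no gluing along integer times: the factors outside the one at time \<open>s\<close> are \<open>\<phi>\<close>, and
those inside it are the identity.\<close>

primrec cascade :: "(real \<times> 'a \<Rightarrow> 'a) \<Rightarrow> nat \<Rightarrow> real \<Rightarrow> 'a \<Rightarrow> 'a" where
  "cascade H 0 t x = x"
| "cascade H (Suc M) t x = H (max 0 (min 1 t), cascade H M (t - 1) x)"

lemma continuous_map_cascade:
  assumes H: "continuous_map (prod_topology (top_of_set {0..1::real}) X) X H"
  shows "continuous_map (prod_topology euclideanreal X) X (\<lambda>p. cascade H M (fst p) (snd p))"
proof (induction M)
  case 0
  then show ?case by (simp add: continuous_map_snd)
next
  case (Suc M)
  have "continuous_map (prod_topology euclideanreal X) (prod_topology euclideanreal X)
      (\<lambda>p. (fst p - 1, snd p))"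
    by (intro continuous_map_pairedI continuous_intros continuous_map_fst continuous_map_snd)
  from continuous_map_compose[OF this Suc.IH]
  have 1: "continuous_map (prod_topology euclideanreal X) X (\<lambda>p. cascade H M (fst p - 1) (snd p))"
    by (simp add: o_def)
  have "continuous_map (prod_topology euclideanreal X) (top_of_set {0..1::real}) (\<lambda>p. max 0 (min 1 (fst p)))"
    by (auto simp: continuous_map_in_subtopology
        intro!: continuous_map_real_max continuous_map_real_min continuous_map_fst)
  from continuous_map_compose[OF continuous_map_pairedI[OF this 1] H]
  show ?case by (simp add: o_def)
qed

lemma cascade_stable_Suc:
  assumes "\<And>x. H (0, x) = x" "t \<le> real M"
  shows "cascade H (Suc M) t x = cascade H M t x"
  using assms(2)
proof (induction M arbitrary: t)
  case 0
  then show ?case by (simp add: assms(1) max_def min_def)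
next
  case (Suc M)
  then show ?case using Suc.IH[of "t - 1"] by simp
qed

lemma cascade_stable:
  assumes "\<And>x. H (0, x) = x" "t \<le> real M" "M \<le> M'"
  shows "cascade H M' t x = cascade H M t x"
  using assms(3)
  by (induction rule: dec_induct) (use assms(2) cascade_stable_Suc[OF assms(1)] in \<open>auto simp del: cascade.simps\<close>)

lemma cascade_eq_iterate:
  assumes "\<And>x. H (1, x) = \<phi> x" "0 \<le> s" "s \<le> 1"
  shows "cascade H (Suc n) (real n + s) x = (\<phi> ^^ n) (H (s, x))"
proof (induction n)
  case 0
  then show ?case using assms(2,3) by (simp add: max_def min_def)
next
  case (Suc n)
  have "max 0 (min 1 (real (Suc n) + s)) = 1" using assms(2) by simp
  then show ?case using Suc by (simp add: assms(1) del: max.absorb1 max.absorb2)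
qed

context lyapunov_pair
begin

text \<open>There is no uniform number of steps that brings the whole space below level \<open>c\<close>, so points have to
be moved for different times, and one must interpolate between \<open>\<phi>\<^sup>n\<close> and \<open>\<phi>\<^sup>n\<^sup>+\<^sup>1\<close> through maps that stay
below \<open>c\<close>. The homotopy \<open>H\<^sub>s \<circ> \<phi>\<^sup>n\<close> is useless for this, because \<open>H\<^sub>s\<close> may raise \<open>f\<close>. The homotopy
\<open>\<phi>\<^sup>n \<circ> H\<^sub>s\<close> works: the path \<open>s \<mapsto> H\<^sub>s x\<close> reaches at most a height \<open>m x\<close>, which depends
continuously on \<open>x\<close>, and from this height a number \<open>n\<close> of steps that depends on \<open>m x\<close> only leads
below \<open>c\<close>. Stopping at a continuous time beyond this number gives a map of \<open>X\<close> into the sublevel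
set which is homotopic to the identity.\<close>

lemma cat_space_le_cat_sublevel:
  assumes b: "b = \<infinity>" and hom: "homotopic_with (\<lambda>h. True) X X \<phi> id"
    and c: "\<And>x. x \<in> F \<Longrightarrow> f x < c"
  shows "cat_in X (topspace X) \<le> cat_in X (S c)"
proof -
  obtain H where H0: "continuous_map (prod_topology (top_of_set {0..1::real}) X) X H"
    "\<forall>x. H (0, x) = id x" "\<forall>x. H (1, x) = \<phi> x"
    using homotopic_with_symD[OF hom] unfolding homotopic_with_def by blast
  have H: "continuous_map (prod_topology (top_of_set {0..1::real}) X) X H"
    "\<And>x. H (0, x) = x" "\<And>x. H (1, x) = \<phi> x"
    using H0 by simp_all
  have "\<exists>n. (\<phi> ^^ n) ` S k \<subseteq> S c" for k :: real
  proof (cases "k < c")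
    case True
    then have "(\<phi> ^^ 0) ` S k \<subseteq> S c" by (auto simp: sublevel_def)
    then show ?thesis by blast
  next
    case False
    have "\<not> (c \<le> f x \<and> f x \<le> k)" if "x \<in> F" for x using c[OF that] by simp
    moreover have "ereal k \<le> b" using b by simp
    ultimately show ?thesis using push_through_regular_band[of k c] by blast
  qed
  then have "\<forall>k::nat. \<exists>n. (\<phi> ^^ n) ` S (real k) \<subseteq> S c" by blast
  from choice[OF this] obtain N where N: "\<And>k::nat. (\<phi> ^^ N k) ` S (real k) \<subseteq> S c"
    by blast
  obtain \<tau> where \<tau>: "continuous_on UNIV \<tau>" "\<And>r. \<tau> r \<ge> 0"
    "\<And>r. \<exists>k. r \<le> real k \<and> real (N k) \<le> \<tau> r"
    using continuous_majorant[of N] by blast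
  define m where "m x = (SUP s\<in>{0..1}. f (H (s, x)))" for x
  have "compact_space (top_of_set {0..1::real})"
    by (simp add: compact_space_subtopology)
  note sup = continuous_map_SUP_compact[OF this _ continuous_map_compose[OF H(1) cont_f],
      unfolded o_def topspace_euclidean_subtopology, folded m_def]
  \<comment> \<open>The integer part of the stopping time has to reach \<open>N k\<close>, hence the additional unit of time.\<close>
  define T where "T x = \<tau> (m x) + 1" for x
  have contT: "continuous_map X euclideanreal T"
    unfolding T_def using continuous_map_compose[OF sup(1), of euclideanreal \<tau>] \<tau>(1)
    by (intro continuous_intros) (auto simp: o_def)
  have T0: "T x \<ge> 0" for x using \<tau>(2)[of "m x"] by (simp add: T_def)
  \<comment> \<open>Only locally is there a bound on the stopping time; the cascades of different lengths agree where
    both are long enough, so they define one homotopy.\<close>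
  define P where "P p = cascade H (nat \<lceil>T (snd p)\<rceil>) (fst p * T (snd p)) (snd p)" for p
  have P_eq: "P (l, x) = cascade H n (l * T x) x" if "l \<in> {0..1}" "T x < real n" for l x n
  proof -
    have "l * T x \<le> T x" using that(1) T0[of x] by (simp add: mult_left_le_one_le)
    also have "T x \<le> real (nat \<lceil>T x\<rceil>)" by (rule real_nat_ceiling_ge)
    finally show ?thesis
      unfolding P_def using cascade_stable[OF H(2), of "l * T x" "nat \<lceil>T x\<rceil>" n x] that(2)
      by (simp add: nat_le_iff ceiling_le_iff)
  qed
  have "continuous_map (prod_topology (top_of_set {0..1::real}) X) X P"
  proof (rule pasting_lemma[where I = UNIV and T = "\<lambda>n::nat. {0..1} \<times> {x \<in> topspace X. T x < real n}"
        and f = "\<lambda>n p. cascade H n (fst p * T (snd p)) (snd p)"])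
    fix n :: nat
    have "openin X {x \<in> topspace X. T x \<in> {..<real n}}"
      by (rule openin_continuous_map_preimage[OF contT]) auto
    then show "openin (prod_topology (top_of_set {0..1::real}) X) ({0..1} \<times> {x \<in> topspace X. T x < real n})"
      by (simp add: openin_prod_Times_iff)
    have "continuous_map (prod_topology (top_of_set {0..1::real}) X) (prod_topology euclideanreal X)
        (\<lambda>p. (fst p * T (snd p), snd p))"
      by (intro continuous_map_pairedI continuous_map_real_mult continuous_map_snd
          continuous_map_compose[OF continuous_map_snd contT, unfolded o_def]
          continuous_map_into_fulltopology[OF continuous_map_fst])
    from continuous_map_compose[OF this continuous_map_cascade[OF H(1)]]
    show "continuous_map (subtopology (prod_topology (top_of_set {0..1::real}) X)
        ({0..1} \<times> {x \<in> topspace X. T x < real n})) X (\<lambda>p. cascade H n (fst p * T (snd p)) (snd p))"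
      by (simp add: o_def continuous_map_from_subtopology)
  next
    fix i j :: nat and p
    assume "p \<in> topspace (prod_topology (top_of_set {0..1::real}) X) \<inter>
      ({0..1} \<times> {x \<in> topspace X. T x < real i}) \<inter> ({0..1} \<times> {x \<in> topspace X. T x < real j})"
    then show "cascade H i (fst p * T (snd p)) (snd p) = cascade H j (fst p * T (snd p)) (snd p)"
      using P_eq[of "fst p" "snd p" i] P_eq[of "fst p" "snd p" j] by auto
  next
    fix p assume p: "p \<in> topspace (prod_topology (top_of_set {0..1::real}) X)"
    obtain n :: nat where n: "T (snd p) < real n" using reals_Archimedean2 by blast
    then show "\<exists>n::nat. n \<in> UNIV \<and> p \<in> {0..1} \<times> {x \<in> topspace X. T x < real n} \<and>
        P p = cascade H n (fst p * T (snd p)) (snd p)"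
      using p P_eq[of "fst p" "snd p" n] by (intro exI[of _ n]) auto
  qed
  moreover have "P (0, x) = x" for x
    using cascade_stable[OF H(2), of 0 0 "nat \<lceil>T x\<rceil>" x] by (simp add: P_def)
  ultimately have "homotopic_with (\<lambda>h. True) X X id (\<lambda>x. P (1, x))"
    unfolding homotopic_with_def by (intro exI[of _ P]) auto
  then have hg: "homotopic_with (\<lambda>h. True) X X (\<lambda>x. P (1, x)) id"
    by (rule homotopic_with_symD)
  have "homotopy_left_invertible X (\<lambda>x. P (1, x))"
    unfolding homotopy_left_invertible_def
  proof (intro conjI exI)
    show "continuous_map X X (\<lambda>x. P (1, x))"
      using homotopic_with_imp_continuous_maps[OF hg] by blast
    show "homotopic_with (\<lambda>h. True) X X (id \<circ> (\<lambda>x. P (1, x))) id" using hg by (simp add: o_def)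
  qed simp
  moreover have "(\<lambda>x. P (1, x)) ` topspace X \<subseteq> S c"
  proof (clarify)
    fix x assume x: "x \<in> topspace X"
    define n where "n = nat \<lfloor>T x\<rfloor>"
    define s where "s = T x - real n"
    have s: "0 \<le> s" "s < 1" using T0[of x] by (auto simp: s_def n_def) linarith+
    have "P (1, x) = cascade H (Suc n) (real n + s) x"
      using P_eq[of 1 x "Suc n"] s by (simp add: s_def del: cascade.simps)
    then have P1: "P (1, x) = (\<phi> ^^ n) (H (s, x))"
      using cascade_eq_iterate[of H \<phi> s n x] H(3) s by simp
    have y: "H (s, x) \<in> topspace X"
      using continuous_map_image_subset_topspace[OF H(1)] s x by (force simp: image_subset_iff)
    obtain k where k: "m x \<le> real k" "real (N k) \<le> \<tau> (m x)" using \<tau>(3) by blast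
    have "f (H (s, x)) \<le> m x" using sup(2)[of x s] x s by auto
    then have "H (s, x) \<in> S (real k)" using y k(1) by (simp add: sublevel_def)
    then have "f ((\<phi> ^^ N k) (H (s, x))) \<le> c" using N[of k] by (auto simp: sublevel_def)
    moreover have "N k \<le> n" using k(2) s by (simp add: s_def T_def)
    ultimately have "f (P (1, x)) \<le> c"
      using f_iterate_antimono[OF y, of "N k" n] P1 by simp
    then show "P (1, x) \<in> S c" using P1 iterate_in[OF y] by (simp add: sublevel_def)
  qed
  ultimately show ?thesis by (intro cat_in_le_of_image) auto
qed

lemma esum_cat_fixed_levels:
  "esum (\<lambda>d. cat_in X (F \<inter> f -` {d})) {d. ereal d \<le> b} =
    (if finite (f ` F \<inter> {d. ereal d \<le> b})
     then \<Sum>d \<in> f ` F \<inter> {d. ereal d \<le> b}. cat_in X (F \<inter> f -` {d}) else \<infinity>)"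
proof -
  have "{d \<in> {d. ereal d \<le> b}. cat_in X (F \<inter> f -` {d}) \<noteq> 0} = f ` F \<inter> {d. ereal d \<le> b}"
    by (auto simp: cat_in_eq_0_iff)
  then show ?thesis by (simp only: esum_def)
qed

text \<open>If infinitely many levels up to \<open>b\<close> carry fixed points, the sum is infinite. Otherwise all of them lie
below some real level \<open>c \<le> b\<close>, which reduces the claim to sublevel sets of real numbers.\<close>

lemma cat_sublevel_le_esum:
  assumes inv: "homotopy_left_invertible X \<phi>" and bdd: "bdd_below (f ` topspace X)"
    and b: "b \<noteq> -\<infinity>" and hom: "b = \<infinity> \<Longrightarrow> homotopic_with (\<lambda>h. True) X X \<phi> id"
  shows "cat_in X (sublevel X f b) \<le> esum (\<lambda>d. cat_in X (F \<inter> f -` {d})) {d. ereal d \<le> b}"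
proof -
  let ?g = "\<lambda>d. cat_in X (F \<inter> f -` {d})"
  show ?thesis
  proof (cases "finite (f ` F \<inter> {d. ereal d \<le> b})")
    case False
    then show ?thesis by (simp add: esum_cat_fixed_levels)
  next
    case fin: True
    have "\<exists>c. ereal c \<le> b \<and> cat_in X (sublevel X f b) \<le> cat_in X (S c)"
    proof (cases b)
      case (real c)
      then show ?thesis by (intro exI[of _ c]) simp
    next
      case PInf
      then have "finite (f ` F)" using fin by simp
      then obtain M where "\<And>y. y \<in> f ` F \<Longrightarrow> y \<le> M"
        using bdd_above_finite by (metis bdd_above_def)
      then have "cat_in X (topspace X) \<le> cat_in X (S (M + 1))"
        using PInf hom by (intro cat_space_le_cat_sublevel) force+
      then show ?thesis using PInf by (intro exI[of _ "M + 1"]) (simp add: sublevel_def)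
    qed (use b in simp)
    then obtain c where c: "ereal c \<le> b" "cat_in X (sublevel X f b) \<le> cat_in X (S c)" by blast
    note c(2)
    also have "cat_in X (S c) \<le> (\<Sum>d \<in> f ` F \<inter> {..c}. ?g d)"
      by (rule cat_sublevel_le_finite_sum[OF inv bdd fin c(1)])
    also have "\<dots> \<le> (\<Sum>d \<in> f ` F \<inter> {d. ereal d \<le> b}. ?g d)"
      using c(1) by (intro sum_mono2[OF fin]) (auto intro: order_trans[of _ "ereal c"])
    also have "\<dots> = esum ?g {d. ereal d \<le> b}" using fin by (simp add: esum_cat_fixed_levels)
    finally show ?thesis .
  qed
qed

end

section \<open>Finite sets in weakly locally contractible spaces\<close>

lemma contractible_in_imp_path_component_of:
  assumes "contractible_in X U" "x \<in> U" "y \<in> U"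
  shows "path_component_of X x y"
proof -
  obtain c h where h: "continuous_map (prod_topology (top_of_set {0..1::real}) (subtopology X U)) X h"
    "\<forall>x. h (0, x) = x" "\<forall>x. h (1, x) = c" and U: "U \<subseteq> topspace X"
    using assms(1) unfolding contractible_in_def homotopic_with_def by blast
  have "path_component_of X z c" if z: "z \<in> U" for z
  proof -
    have "continuous_map (top_of_set {0..1::real}) X (\<lambda>t. h (t, z))"
      using continuous_map_slice[OF h(1), of z] z U by auto
    then show ?thesis
      using h(2,3) unfolding path_component_of_def pathin_def by (intro exI[of _ "\<lambda>t. h (t, z)"]) auto
  qed
  then show ?thesis using assms(2,3) path_component_of_sym path_component_of_trans by metis
qed

text \<open>A set contractible in \<open>X\<close> lies in one path component of \<open>X\<close>, so weak local contractibility makes the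
path components open.\<close>

lemma path_connected_space_if_weakly_locally_contractible:
  assumes conn: "connected_space X" and wlc: "weakly_locally_contractible X"
  shows "path_connected_space X"
proof -
  let ?P = "\<lambda>x. Collect (path_component_of X x)"
  have op: "openin X (?P x)" for x
  proof (subst openin_subopen, clarify)
    fix y assume y: "path_component_of X x y"
    then have "y \<in> topspace X" using path_component_in_topspace by metis
    then obtain N U where N: "contractible_in X N" "openin X U" "y \<in> U" "U \<subseteq> N"
      using wlc unfolding weakly_locally_contractible_def neighbourhood_in_def by blast
    have "U \<subseteq> ?P x"
    proof
      fix z assume "z \<in> U"
      then have "path_component_of X y z"
        using contractible_in_imp_path_component_of[OF N(1)] N(3,4) by blast
      then show "z \<in> ?P x" using y path_component_of_trans by fastforce
    qed
    then show "\<exists>T. openin X T \<and> y \<in> T \<and> T \<subseteq> ?P x" using N by blast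
  qed
  have "path_component_of X x y" if x: "x \<in> topspace X" and y: "y \<in> topspace X" for x y
  proof -
    have "topspace X - ?P x = \<Union>(?P ` (topspace X - ?P x))"
    proof (intro equalityI subsetI)
      fix z assume "z \<in> topspace X - ?P x"
      moreover from this have "z \<in> ?P z" by (simp add: path_component_of_refl)
      ultimately show "z \<in> \<Union>(?P ` (topspace X - ?P x))" by blast
    next
      fix z assume "z \<in> \<Union>(?P ` (topspace X - ?P x))"
      then obtain w where w: "\<not> path_component_of X x w" "path_component_of X w z" by blast
      then have "\<not> path_component_of X x z"
        using path_component_of_sym path_component_of_trans by metis
      moreover have "z \<in> topspace X" using path_component_in_topspace[OF w(2)] by simp
      ultimately show "z \<in> topspace X - ?P x" by simp
    qed
    moreover have "openin X (\<Union>(?P ` (topspace X - ?P x)))" using op by blast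
    ultimately have "closedin X (?P x)"
      by (simp add: closedin_def path_component_of_subset_topspace)
    moreover have "x \<in> ?P x" using x by (simp add: path_component_of_refl)
    ultimately have "?P x = topspace X" using op conn unfolding connected_space_clopen_in by blast
    then show ?thesis using y by blast
  qed
  then show ?thesis by (simp add: path_connected_space_iff_path_component)
qed

text \<open>In a path connected space both null-homotopies can be made to end at the same point.\<close>

lemma contractible_in_disjoint_Un:
  assumes X: "path_connected_space X" and U: "openin X U" "contractible_in X U"
    and V: "openin X V" "contractible_in X V" and disj: "disjnt U V"
  shows "contractible_in X (U \<union> V)"
proof -
  obtain c where c: "c \<in> topspace X"
    "homotopic_with (\<lambda>h. True) (subtopology X U) X (\<lambda>x. x) (\<lambda>x. c)"
    using U(2) unfolding contractible_in_def by blast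
  obtain d where d: "d \<in> topspace X"
    "homotopic_with (\<lambda>h. True) (subtopology X V) X (\<lambda>x. x) (\<lambda>x. d)"
    using V(2) unfolding contractible_in_def by blast
  have "path_component_of X d c"
    using X c(1) d(1) by (simp add: path_connected_space_iff_path_component)
  then have "homotopic_with (\<lambda>h. True) (subtopology X V) X (\<lambda>x. d) (\<lambda>x. c)"
    by (simp add: homotopic_constant_maps)
  from homotopic_with_trans[OF d(2) this]
  obtain k where k: "continuous_map (prod_topology (top_of_set {0..1::real}) (subtopology X V)) X k"
    "\<forall>x. k (0, x) = x" "\<forall>x. k (1, x) = c" unfolding homotopic_with_def by blast
  obtain h where h: "continuous_map (prod_topology (top_of_set {0..1::real}) (subtopology X U)) X h"
    "\<forall>x. h (0, x) = x" "\<forall>x. h (1, x) = c" using c(2) unfolding homotopic_with_def by blast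
  let ?Y = "prod_topology (top_of_set {0..1::real}) (subtopology X (U \<union> V))"
  have sub: "subtopology ?Y ({0..1} \<times> W) = prod_topology (top_of_set {0..1}) (subtopology X W)"
    if "W \<subseteq> U \<union> V" for W
    using that by (simp add: subtopology_Times subtopology_subtopology Int_absorb1)
  have opW: "openin ?Y ({0..1} \<times> W)" if "openin X W" "W \<subseteq> U \<union> V" for W
    using that by (auto simp: openin_prod_Times_iff openin_subtopology)
  have cont: "continuous_map ?Y X (\<lambda>p. if snd p \<in> U then h p else k p)"
  proof (rule pasting_lemma[where I = UNIV and T = "\<lambda>i. {0..1} \<times> (if i then U else V)"
        and f = "\<lambda>i. if i then h else k"])
    fix i :: bool
    show "openin ?Y ({0..1} \<times> (if i then U else V))"
      using opW U(1) V(1) by simp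
    show "continuous_map (subtopology ?Y ({0..1} \<times> (if i then U else V))) X (if i then h else k)"
      using h(1) k(1) sub[of U] sub[of V] by simp
  next
    fix i j :: bool and p
    assume "p \<in> topspace ?Y \<inter> {0..1} \<times> (if i then U else V) \<inter> {0..1} \<times> (if j then U else V)"
    then have "i = j" using disj by (auto simp: disjnt_iff mem_Times_iff split: if_splits)
    then show "(if i then h else k) p = (if j then h else k) p" by simp
  next
    fix p assume "p \<in> topspace ?Y"
    then show "\<exists>j. j \<in> UNIV \<and> p \<in> {0..1} \<times> (if j then U else V) \<and>
        (if snd p \<in> U then h p else k p) = (if j then h else k) p"
      by (intro exI[of _ "snd p \<in> U"]) (auto simp: mem_Times_iff)
  qed
  have "homotopic_with (\<lambda>h. True) (subtopology X (U \<union> V)) X (\<lambda>x. x) (\<lambda>x. c)"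
    unfolding homotopic_with_def
    using cont h(2,3) k(2,3) by (intro exI[of _ "\<lambda>p. if snd p \<in> U then h p else k p"]) simp
  then show ?thesis
    using c(1) U(1) V(1) unfolding contractible_in_def by (auto dest: openin_subset)
qed

lemma finite_set_contractible_nbhd:
  assumes H: "Hausdorff_space X" and pc: "path_connected_space X"
    and wlc: "weakly_locally_contractible X" and A: "finite A" "A \<noteq> {}" "A \<subseteq> topspace X"
  shows "\<exists>U. openin X U \<and> A \<subseteq> U \<and> contractible_in X U"
  using A
proof (induction rule: finite_ne_induct)
  case (singleton x)
  then obtain N U where "contractible_in X N" "openin X U" "x \<in> U" "U \<subseteq> N"
    using wlc unfolding weakly_locally_contractible_def neighbourhood_in_def by blast
  then show ?case using contractible_in_subset by blast
next
  case (insert a A)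
  then obtain U where U: "openin X U" "A \<subseteq> U" "contractible_in X U" by auto
  from insert.prems obtain N V where "contractible_in X N" "openin X V" "a \<in> V" "V \<subseteq> N"
    using wlc unfolding weakly_locally_contractible_def neighbourhood_in_def by blast
  then have V: "openin X V" "a \<in> V" "contractible_in X V" using contractible_in_subset by blast+
  have "compactin X A" "compactin X {a}" "disjnt A {a}"
    using insert by (auto intro: finite_imp_compactin)
  then obtain U' V' where W: "openin X U'" "openin X V'" "A \<subseteq> U'" "{a} \<subseteq> V'" "disjnt U' V'"
    using Hausdorff_space_compact_separation[OF H] by metis
  have "contractible_in X ((U \<inter> U') \<union> (V \<inter> V'))"
  proof (rule contractible_in_disjoint_Un[OF pc])
    show "contractible_in X (U \<inter> U')" "contractible_in X (V \<inter> V')"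
      using U(3) V(3) contractible_in_subset by blast+
    show "disjnt (U \<inter> U') (V \<inter> V')" using W(5) by (auto simp: disjnt_iff)
  qed (use U V W in auto)
  moreover have "openin X ((U \<inter> U') \<union> (V \<inter> V'))" using U V W by blast
  moreover have "insert a A \<subseteq> (U \<inter> U') \<union> (V \<inter> V')" using U V W by blast
  ultimately show ?case by blast
qed

lemma cat_in_finite_le_1:
  assumes "Hausdorff_space X" "connected_space X" "weakly_locally_contractible X"
    and A: "finite A" "A \<subseteq> topspace X"
  shows "cat_in X A \<le> 1"
proof (cases "A = {}")
  case False
  then obtain U where "openin X U" "A \<subseteq> U" "contractible_in X U"
    using finite_set_contractible_nbhd path_connected_space_if_weakly_locally_contractible assms
    by metis
  then show ?thesis using cat_in_le[of "{U}" X A] by (simp add: one_enat_def)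
qed (simp add: cat_in_empty)

section \<open>Closed subspaces of absolute neighbourhood retracts\<close>

text \<open>A test space may live on any type: it suffices that its points inject into the universe type \<open>'u\<close>.
The space is copied onto the image of an injection.\<close>

lemma ANR_extension:
  assumes ANR: "ANR_space TYPE('u) X" and small: "topspace Y \<lesssim> (UNIV :: 'u set)"
    and Y: "Hausdorff_space Y" "normal_space Y" and Z: "closedin Y Z"
    and g: "continuous_map (subtopology Y Z) X g"
  obtains N h where "openin Y N" "Z \<subseteq> N" "continuous_map (subtopology Y N) X h"
    "\<And>z. z \<in> Z \<Longrightarrow> h z = g z"
proof -
  obtain e :: "'b \<Rightarrow> 'u" where e: "inj_on e (topspace Y)"
    using small unfolding lepoll_def by blast
  define i where "i = inv_into (topspace Y) e"
  define Y' where "Y' = pullback_topology (e ` topspace Y) i Y"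
  have ie: "i (e y) = y" if "y \<in> topspace Y" for y
    using e that by (simp add: i_def)
  have topY': "topspace Y' = e ` topspace Y"
    by (auto simp: Y'_def topspace_pullback_topology ie)
  have homeo: "homeomorphic_maps Y Y' e i"
    unfolding homeomorphic_maps_def
  proof (intro conjI ballI)
    show "continuous_map Y Y' e"
      unfolding continuous_map_alt
    proof (intro conjI strip)
      fix W assume "openin Y' W"
      then obtain U where U: "openin Y U" "W = i -` U \<inter> e ` topspace Y"
        by (auto simp: Y'_def openin_pullback_topology)
      have "e -` W \<inter> topspace Y = U"
        using openin_subset[OF U(1)] ie by (fastforce simp: U(2))
      then show "openin Y (e -` W \<inter> topspace Y)" using U(1) by simp
    qed (auto simp: topY')
    show "continuous_map Y' Y i"
      unfolding continuous_map_alt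
    proof (intro conjI strip)
      fix U assume U: "openin Y U"
      show "openin Y' (i -` U \<inter> topspace Y')"
        using U unfolding topY' by (auto simp: Y'_def openin_pullback_topology)
    qed (auto simp: topY' ie)
  qed (auto simp: topY' ie)
  then have sp: "Y homeomorphic_space Y'" unfolding homeomorphic_space_def by blast
  have ce: "continuous_map Y Y' e" and ci: "continuous_map Y' Y i"
    using homeo by (auto simp: homeomorphic_maps_def)
  have ZY: "Z \<subseteq> topspace Y" using Z by (rule closedin_subset)
  have "closedin Y' (e ` Z)"
    using homeo Z by (metis homeomorphic_map_closedness_eq homeomorphic_map_maps)
  moreover have "continuous_map (subtopology Y' (e ` Z)) X (g \<circ> i)"
  proof (rule continuous_map_compose[OF _ g])
    show "continuous_map (subtopology Y' (e ` Z)) (subtopology Y Z) i"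
      using ci ZY ie by (auto simp: continuous_map_in_subtopology continuous_map_from_subtopology)
  qed
  moreover have "Hausdorff_space Y'" "normal_space Y'"
    using Y sp homeomorphic_Hausdorff_space homeomorphic_normal_space by blast+
  ultimately obtain N' h' where N': "neighbourhood_in Y' (e ` Z) N'"
    "continuous_map (subtopology Y' N') X h'" "\<forall>z\<in>e ` Z. h' z = (g \<circ> i) z"
    using ANR unfolding ANR_space_def by blast
  then obtain U' where U': "openin Y' U'" "e ` Z \<subseteq> U'" "U' \<subseteq> N'"
    unfolding neighbourhood_in_def by blast
  define N where "N = {y \<in> topspace Y. e y \<in> U'}"
  show ?thesis
  proof (rule that[of N "h' \<circ> e"])
    show "openin Y N" unfolding N_def by (rule openin_continuous_map_preimage[OF ce U'(1)])
    show "Z \<subseteq> N" using ZY U'(2) by (auto simp: N_def)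
    show "continuous_map (subtopology Y N) X (h' \<circ> e)"
    proof (rule continuous_map_compose[OF _ N'(2)])
      show "continuous_map (subtopology Y N) (subtopology Y' N') e"
        using ce U'(3)
        by (auto simp: continuous_map_in_subtopology continuous_map_from_subtopology N_def)
    qed
    show "(h' \<circ> e) z = g z" if "z \<in> Z" for z using N'(3) that ZY ie by auto
  qed
qed

text \<open>Borsuk's argument: on the closed set \<open>X \<times> {0} \<union> X \<times> {1} \<union> C \<times> [0,1]\<close> take the identity, a constant
and the contraction of \<open>C\<close>, and extend to a neighbourhood of this set. By compactness of the
interval this neighbourhood contains \<open>W \<times> [0,1]\<close> for some open \<open>W\<close> around \<open>C\<close>.\<close>

lemma ANR_contractible_nbhd:
  assumes ANR: "ANR_space TYPE('u) X"
    and small: "topspace X \<times> {0..1::real} \<lesssim> (UNIV :: 'u set)"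
    and X: "Hausdorff_space X" "binormal_space X" and C: "closedin X C" "contractible_in X C"
  obtains W where "openin X W" "C \<subseteq> W" "contractible_in X W"
proof -
  let ?I = "top_of_set {0..1::real}"
  let ?Y = "prod_topology X ?I"
  obtain c k where c: "c \<in> topspace X" and k: "continuous_map (prod_topology ?I (subtopology X C)) X k"
    "\<forall>x. k (0, x) = x" "\<forall>x. k (1, x) = c"
    using C(2) unfolding contractible_in_def homotopic_with_def by blast
  have CX: "C \<subseteq> topspace X" using C(1) by (rule closedin_subset)
  define T :: "nat \<Rightarrow> ('a \<times> real) set" where
    "T i = (if i = 0 then topspace X \<times> {0} else if i = 1 then topspace X \<times> {1} else C \<times> {0..1})" for i
  define G :: "nat \<Rightarrow> 'a \<times> real \<Rightarrow> 'a" where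
    "G i p = (if i = 0 then fst p else if i = 1 then c else k (snd p, fst p))" for i p
  define g where "g p = (if snd p = 0 then G 0 p else if snd p = 1 then G 1 p else G 2 p)" for p
  define Z where "Z = (\<Union>i\<in>{0,1,2}. T i)"
  have clT: "closedin ?Y (T i)" for i
    using C(1) by (auto simp: T_def closedin_prod_Times_iff closedin_subtopology_refl
        intro!: closedin_closed_subset[of "{0..1}"] closed_subset)
  have contG: "continuous_map (subtopology ?Y (T i)) X (G i)" if "i \<in> {0,1,2}" for i
  proof -
    have "continuous_map (subtopology ?Y (C \<times> {0..1})) (prod_topology ?I (subtopology X C))
        (\<lambda>p. (snd p, fst p))"
      using CX
      by (auto simp: continuous_map_pairwise o_def continuous_map_in_subtopology
          intro!: continuous_map_pairedI continuous_map_from_subtopology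
            continuous_map_fst continuous_map_snd
            continuous_map_into_fulltopology[OF continuous_map_snd])
    from continuous_map_compose[OF this k(1)]
    have "continuous_map (subtopology ?Y (T 2)) X (G 2)"
      by (simp add: T_def G_def[abs_def] o_def)
    moreover have "continuous_map (subtopology ?Y (T 0)) X (G 0)"
      by (simp add: G_def[abs_def] continuous_map_from_subtopology continuous_map_fst)
    moreover have "continuous_map (subtopology ?Y (T 1)) X (G 1)"
      using c by (simp add: G_def[abs_def])
    ultimately show ?thesis using that by auto
  qed
  have "continuous_map (subtopology ?Y Z) X g"
  proof (rule pasting_lemma_closed[where I = "{0,1,2}" and T = T and f = G])
    fix i :: nat assume i: "i \<in> {0,1,2}"
    then have TZ: "T i \<subseteq> Z" unfolding Z_def by blast
    then show "closedin (subtopology ?Y Z) (T i)"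
      using clT by (simp add: closedin_subset_topspace)
    show "continuous_map (subtopology (subtopology ?Y Z) (T i)) X (G i)"
      using contG[OF i] TZ by (simp add: subtopology_subtopology Int_absorb1)
  next
    fix i j :: nat and p
    assume "i \<in> {0,1,2}" "j \<in> {0,1,2}" "p \<in> topspace (subtopology ?Y Z) \<inter> T i \<inter> T j"
    then show "G i p = G j p" using k(2,3) by (auto simp: T_def G_def)
  next
    fix p assume "p \<in> topspace (subtopology ?Y Z)"
    then obtain j where j: "j \<in> {0,1,2}" "p \<in> T j" unfolding Z_def by auto
    then have "g p = G j p" using k(2,3) by (auto simp: T_def g_def G_def)
    then show "\<exists>j. j \<in> {0,1,2} \<and> p \<in> T j \<and> g p = G j p" using j by blast
  qed simp
  moreover have "closedin ?Y Z" unfolding Z_def using clT by (intro closedin_Union) auto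
  moreover have "Hausdorff_space ?Y"
    using X(1) by (simp add: Hausdorff_space_prod_topology Hausdorff_space_subtopology)
  moreover have "normal_space ?Y" using X(2) by (simp add: binormal_space_def)
  moreover have "topspace ?Y \<lesssim> (UNIV :: 'u set)" using small by simp
  ultimately obtain N h where N: "openin ?Y N" "Z \<subseteq> N" "continuous_map (subtopology ?Y N) X h"
    "\<And>z. z \<in> Z \<Longrightarrow> h z = g z"
    using ANR_extension[OF ANR, of ?Y Z g] by metis
  define W where "W = \<Union>{U. openin X U \<and> U \<times> {0..1} \<subseteq> N}"
  have WN: "W \<times> {0..1} \<subseteq> N" by (auto simp: W_def)
  have opW: "openin X W" unfolding W_def by blast
  then have WX: "W \<subseteq> topspace X" by (rule openin_subset)
  have "C \<subseteq> W"
  proof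
    fix x assume x: "x \<in> C"
    have "{x} \<times> {0..1} \<subseteq> N" using x N(2) by (auto simp: Z_def T_def)
    moreover have "compactin ?I {0..1}" by (simp add: compactin_subtopology)
    ultimately obtain U V where "openin X U" "x \<in> U" "{0..1} \<subseteq> V" "U \<times> V \<subseteq> N"
      using tube_lemma_right[OF N(1), of "{0..1}" x] x CX by blast
    then show "x \<in> W" unfolding W_def by blast
  qed
  moreover have "contractible_in X W"
    unfolding contractible_in_def
  proof (intro conjI bexI[of _ c])
    have "continuous_map (prod_topology ?I (subtopology X W)) (subtopology ?Y N) (\<lambda>p. (snd p, fst p))"
      using WN
      by (auto simp: continuous_map_in_subtopology
          intro!: continuous_map_pairedI continuous_map_fst
            continuous_map_into_fulltopology[OF continuous_map_snd])
    from continuous_map_compose[OF this N(3)]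
    have cont: "continuous_map (prod_topology ?I (subtopology X W)) X (\<lambda>p. h (snd p, fst p))"
      by (simp add: o_def)
    have ends: "h (x, 0) = x" "h (x, 1) = c" if "x \<in> W" for x
      using N(4)[of "(x, 0)"] N(4)[of "(x, 1)"] that WX by (auto simp: Z_def T_def g_def G_def)
    have "\<exists>H. continuous_map (prod_topology ?I (subtopology X W)) X H \<and>
        (\<forall>x\<in>topspace (subtopology X W). H (0, x) = x) \<and>
        (\<forall>x\<in>topspace (subtopology X W). H (1, x) = c) \<and> (\<forall>t\<in>{0..1}. True)"
      using cont ends by (intro exI[of _ "\<lambda>p. h (snd p, fst p)"]) auto
    then show "homotopic_with (\<lambda>h. True) (subtopology X W) X (\<lambda>x. x) (\<lambda>x. c)"
      by (subst homotopic_with) auto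
  qed (use WX c in auto)
  ultimately show ?thesis using that opW by blast
qed

lemma contractible_in_subspace:
  assumes "contractible_in (subtopology X B) A"
  shows "contractible_in X A"
proof -
  obtain c where c: "c \<in> topspace X" "c \<in> B"
    "homotopic_with (\<lambda>h. True) (subtopology (subtopology X B) A) (subtopology X B) (\<lambda>x. x) (\<lambda>x. c)"
    and A: "A \<subseteq> topspace X" "A \<subseteq> B"
    using assms unfolding contractible_in_def by auto
  have "homotopic_with (\<lambda>h. True) (subtopology (subtopology X B) A) X (id \<circ> (\<lambda>x. x)) (id \<circ> (\<lambda>x. c))"
    by (rule homotopic_with_compose_continuous_map_left[OF c(3)])
      (auto intro: continuous_map_from_subtopology)
  then show ?thesis
    using c(1) A by (auto simp: contractible_in_def subtopology_subtopology Int_absorb1 o_def)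
qed

text \<open>A cover of \<open>B\<close> by sets open in \<open>B\<close> is first shrunk to a cover by closed sets, using normality, since
only closed sets have contractible neighbourhoods in \<open>X\<close> by the previous argument. The induction
does both at once: it splits off one closed set at a time.\<close>

lemma cat_in_le_cat_space_closed_subspace:
  assumes ANR: "ANR_space TYPE('u) X"
    and small: "topspace X \<times> {0..1::real} \<lesssim> (UNIV :: 'u set)"
    and X: "Hausdorff_space X" "binormal_space X" and B: "closedin X B"
  shows "cat_in X B \<le> cat_space (subtopology X B)"
proof (cases "cat_space (subtopology X B) = \<infinity>")
  case False
  let ?B = "subtopology X B"
  have BX: "B \<subseteq> topspace X" using B by (rule closedin_subset)
  have "topspace (top_of_set {0..1::real}) \<noteq> {}" by simp
  then have "retraction_map (prod_topology X (top_of_set {0..1::real})) X fst"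
    unfolding retraction_map_fst null_topspace_iff_trivial by blast
  then have "normal_space X"
    using X(2) normal_space_retraction_map_image unfolding binormal_space_def by blast
  then have normB: "normal_space ?B" using B by (rule normal_space_closed_subtopology)
  have claim: "cat_in X A \<le> enat (card \<V>)"
    if "finite \<V>" "\<And>V. V \<in> \<V> \<Longrightarrow> openin ?B V \<and> contractible_in ?B V" "closedin ?B A" "A \<subseteq> \<Union>\<V>"
    for \<V> A
    using that
  proof (induction \<V> arbitrary: A rule: finite_induct)
    case empty
    then show ?case by (simp add: cat_in_empty)
  next
    case (insert V \<V>)
    have "closedin ?B (A - \<Union>\<V>)"
      using insert.prems by (intro closedin_diff openin_Union) auto
    moreover have "openin ?B V" "A - \<Union>\<V> \<subseteq> V" using insert.prems by auto
    ultimately obtain O' where O': "openin ?B O'" "A - \<Union>\<V> \<subseteq> O'" "?B closure_of O' \<subseteq> V"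
      using normB unfolding normal_space_alt by metis
    let ?C = "?B closure_of O'"
    have "closedin X ?C" using B by (meson closedin_closure_of closedin_trans_full)
    moreover have "contractible_in X ?C"
      using contractible_in_subset[OF _ O'(3)] contractible_in_subspace insert.prems(1) by blast
    ultimately obtain W where "openin X W" "?C \<subseteq> W" "contractible_in X W"
      using ANR_contractible_nbhd[OF ANR small X] by metis
    then have "cat_in X ?C \<le> 1"
      using cat_in_le[of "{W}" X ?C] by (simp add: one_enat_def)
    moreover have "cat_in X (A - O') \<le> enat (card \<V>)"
      using insert.prems O' by (intro insert.IH) (auto intro: closedin_diff)
    moreover have "A \<subseteq> ?C \<union> (A - O')"
      using closure_of_subset[OF openin_subset[OF O'(1)]] by blast
    ultimately have "cat_in X A \<le> 1 + enat (card \<V>)"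
      by (meson add_mono cat_in_Un cat_in_mono order_trans)
    then show ?case using insert.hyps by (simp add: one_enat_def)
  qed
  obtain \<V> where \<V>: "finite \<V>" "\<And>V. V \<in> \<V> \<Longrightarrow> openin ?B V \<and> contractible_in ?B V"
    "topspace ?B \<subseteq> \<Union>\<V>" "cat_space ?B = enat (card \<V>)"
    using False cat_in_cover[of ?B "topspace ?B"] unfolding cat_space_def by metis
  have "closedin ?B B" using closedin_topspace[of ?B] BX by (simp add: Int_absorb1)
  then show ?thesis using claim[OF \<V>(1,2), of B] \<V>(3,4) BX by (simp add: Int_absorb1)
qed simp

section \<open>Spaces split by a function with discrete values\<close>

text \<open>Isolated points are open and closed in a discrete set, so its connected subsets are trivial.\<close>

lemma discrete_connected_subset_eq:
  fixes D :: "'a::t1_space set"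
  assumes "discrete D" "connected T" "T \<subseteq> D" "x \<in> T" "y \<in> T"
  shows "x = y"
proof -
  obtain U where U: "open U" "U \<inter> D = {x}"
    using assms unfolding discrete_def isolated_in_def by blast
  have "T \<inter> U = {x}" using U assms by blast
  then have "openin (top_of_set T) {x}" using U(1) by (metis openin_open_Int)
  moreover have "closedin (top_of_set T) {x}" using assms(4) by (simp add: closed_subset)
  ultimately have "T = {x}" using assms(2) unfolding connected_clopen by blast
  then show ?thesis using assms(5) by simp
qed

text \<open>A set contractible in \<open>G\<close> lies in a path component of \<open>G\<close>, and on path components \<open>f\<close> is constant
because its values form a discrete set. So a finite cover of \<open>G\<close> by such sets has its members
distributed among the fibres of \<open>f\<close>. The contractions take place within the fibres, too, for the
same reason. In particular only finitely many fibres are nonempty, although a discrete set of values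
may well be infinite and accumulate outside itself.\<close>

lemma sum_cat_space_fibres_le:
  fixes f :: "'a \<Rightarrow> real"
  assumes f: "continuous_map X euclideanreal f" and disc: "discrete (f ` G)"
    and fin: "cat_space (subtopology X G) \<noteq> \<infinity>" and G: "G \<subseteq> topspace X"
  shows "finite (f ` G)"
    and "(\<Sum>d\<in>f ` G. cat_space (subtopology X (G \<inter> f -` {d}))) \<le> cat_space (subtopology X G)"
proof -
  let ?G = "subtopology X G"
  have top: "topspace ?G = G" using G by (simp add: Int_absorb1)
  obtain \<U> where \<U>: "finite \<U>" "\<And>U. U \<in> \<U> \<Longrightarrow> openin ?G U \<and> contractible_in ?G U" "G \<subseteq> \<Union>\<U>"
    "cat_space ?G = enat (card \<U>)"
    using fin cat_in_cover[of ?G "topspace ?G"] unfolding cat_space_def top by metis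
  have const: "f x = f y" if "path_component_of ?G x y" for x y
  proof -
    from iffD1[OF path_component_of that]
    obtain T where T: "path_connectedin ?G T" "x \<in> T" "y \<in> T" by blast
    have "continuous_map ?G euclideanreal f" using f by (rule continuous_map_from_subtopology)
    from connectedin_continuous_map_image[OF this path_connectedin_imp_connectedin[OF T(1)]]
    have "connected (f ` T)" by simp
    moreover have "T \<subseteq> G" using path_connectedin_subset_topspace[OF T(1)] top by simp
    ultimately show ?thesis using discrete_connected_subset_eq[OF disc] T by blast
  qed
  have constU: "f x = f y" if "U \<in> \<U>" "x \<in> U" "y \<in> U" for U x y
    using const contractible_in_imp_path_component_of \<U>(2) that by metis
  have "f ` G \<subseteq> (\<lambda>U. f (SOME x. x \<in> U)) ` \<U>"
  proof clarify
    fix x assume "x \<in> G"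
    then obtain U where U: "U \<in> \<U>" "x \<in> U" using \<U>(3) by blast
    then have "f x = f (SOME x. x \<in> U)" using constU someI by metis
    then show "f x \<in> (\<lambda>U. f (SOME x. x \<in> U)) ` \<U>" using U(1) by blast
  qed
  then show finf: "finite (f ` G)" using \<U>(1) finite_surj by blast
  define \<V> where "\<V> d = {U \<in> \<U>. U \<inter> f -` {d} \<noteq> {}}" for d
  have "cat_space (subtopology X (G \<inter> f -` {d})) \<le> enat (card (\<V> d))" for d
  proof -
    let ?B = "G \<inter> f -` {d}"
    have topB: "topspace (subtopology X ?B) = ?B" using G by auto
    have sub: "U \<subseteq> ?B" if "U \<in> \<V> d" for U
    proof
      fix x assume x: "x \<in> U"
      have "U \<in> \<U>" using that by (simp add: \<V>_def)
      then have "U \<subseteq> G" using \<U>(2) openin_subset top by metis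
      moreover from that obtain y where "U \<in> \<U>" "y \<in> U" "f y = d" by (auto simp: \<V>_def)
      then have "f x = d" using constU[of U x y] x by simp
      ultimately show "x \<in> ?B" using x by blast
    qed
    have "openin (subtopology X ?B) U \<and> contractible_in (subtopology X ?B) U" if U: "U \<in> \<V> d" for U
    proof
      have UU: "openin ?G U" "contractible_in ?G U" using U \<U>(2) by (auto simp: \<V>_def)
      then obtain U' where "openin X U'" "U = U' \<inter> G" by (auto simp: openin_subtopology)
      then show "openin (subtopology X ?B) U"
        using sub[OF U] by (auto simp: openin_subtopology intro!: exI[of _ U'])
      obtain c h where c: "c \<in> G"
        and h: "continuous_map (prod_topology (top_of_set {0..1::real}) (subtopology ?G U)) ?G h"
        "\<forall>x. h (0, x) = x" "\<forall>x. h (1, x) = c"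
        using UU(2) unfolding contractible_in_def homotopic_with_def top by blast
      have eq: "subtopology ?G U = subtopology X U" "subtopology (subtopology X ?B) U = subtopology X U"
        using sub[OF U] by (auto simp: subtopology_subtopology Int_absorb1)
      have UG: "U \<subseteq> G" using sub[OF U] by blast
      have fh: "f (h (t, x)) = d" if "t \<in> {0..1}" "x \<in> U" for t x
      proof -
        have "continuous_map (top_of_set {0..1::real}) ?G (\<lambda>t. h (t, x))"
          using continuous_map_slice[OF h(1), of x] that(2) UG G by auto
        then have "path_connectedin ?G ((\<lambda>t. h (t, x)) ` {0..1})"
          by (intro path_connectedin_continuous_map_image[of "top_of_set {0..1}"])
            (auto simp: path_connectedin_subtopology is_interval_cc is_interval_path_connected)
        then have "path_component_of ?G (h (0, x)) (h (t, x))"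
          unfolding path_component_of using that(1) by (intro exI[of _ "(\<lambda>t. h (t, x)) ` {0..1}"]) auto
        then have "f (h (0, x)) = f (h (t, x))" by (rule const)
        then show ?thesis using h(2) sub[OF U] that(2) by auto
      qed
      have "continuous_map (prod_topology (top_of_set {0..1::real}) (subtopology (subtopology X ?B) U))
          (subtopology X ?B) h"
        using h(1) fh unfolding eq by (auto simp: continuous_map_in_subtopology)
      then have "homotopic_with (\<lambda>h. True) (subtopology (subtopology X ?B) U) (subtopology X ?B)
          (\<lambda>x. x) (\<lambda>x. c)"
        using h(2,3) unfolding homotopic_with_def by blast
      moreover have "c \<in> ?B"
      proof -
        obtain x where "x \<in> U" using U by (auto simp: \<V>_def)
        then show ?thesis using fh[of 1 x] h(3) c by auto
      qed
      ultimately show "contractible_in (subtopology X ?B) U"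
        unfolding contractible_in_def topB using sub[OF U] by blast
    qed
    moreover have "?B \<subseteq> \<Union>(\<V> d)" using \<U>(3) unfolding \<V>_def by blast
    ultimately show ?thesis
      unfolding cat_space_def topB by (intro cat_in_le) (use \<U>(1) in \<open>auto simp: \<V>_def\<close>)
  qed
  then have "(\<Sum>d\<in>f ` G. cat_space (subtopology X (G \<inter> f -` {d}))) \<le> (\<Sum>d\<in>f ` G. enat (card (\<V> d)))"
    by (intro sum_mono)
  also have "\<dots> = enat (\<Sum>d\<in>f ` G. card (\<V> d))" by (simp flip: of_nat_eq_enat)
  also have "(\<Sum>d\<in>f ` G. card (\<V> d)) = card (\<Union>d\<in>f ` G. \<V> d)"
  proof (rule card_UN_disjoint[symmetric])
    show "\<forall>d\<in>f ` G. \<forall>d'\<in>f ` G. d \<noteq> d' \<longrightarrow> \<V> d \<inter> \<V> d' = {}"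
      using constU unfolding \<V>_def by blast
  qed (use finf \<U>(1) in \<open>auto simp: \<V>_def\<close>)
  also have "card (\<Union>d\<in>f ` G. \<V> d) \<le> card \<U>"
    by (intro card_mono \<U>(1)) (auto simp: \<V>_def)
  finally show "(\<Sum>d\<in>f ` G. cat_space (subtopology X (G \<inter> f -` {d}))) \<le> cat_space ?G"
    using \<U>(4) by simp
qed

section \<open>The Lusternik--Schnirelmann theorem for fixed points\<close>

theorem theorem1p2:
  fixes X :: "'a topology" and \<phi> :: "'a \<Rightarrow> 'a" and f :: "'a \<Rightarrow> real" and b :: ereal
    and F :: "'a set"
  assumes "Hausdorff_space X"
    and "homotopy_equivalence_map X X \<phi>"
    and F: "F = fixed_points X \<phi>"
    and "continuous_map X euclideanreal f"
    and "bdd_below (f ` topspace X)"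
    and "b \<noteq> -\<infinity>"
    and "b = \<infinity> \<Longrightarrow> homotopic_with (\<lambda>h. True) X X \<phi> id"
    and "condition_D X f \<phi> (sublevel X f b)"
  shows "esum (\<lambda>d. cat_in X (F \<inter> f -` {d})) {d :: real. ereal d \<le> b} \<ge> cat_in X (sublevel X f b)
    \<and> (connected_space X \<and> weakly_locally_contractible X \<longrightarrow>
         infinite (F \<inter> sublevel X f b) \<or>
         ecard (f ` F \<inter> {d. ereal d \<le> b}) \<ge> cat_in X (sublevel X f b))
    \<and> (topspace X \<times> {0..1::real} \<lesssim> (UNIV :: 'u set) \<and>
         binormal_space X \<and> ANR_space TYPE('u) X \<and> discrete (f ` F) \<longrightarrow>
         cat_space (subtopology X (F \<inter> sublevel X f b)) \<ge> cat_in X (sublevel X f b))"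
proof -
  note X = assms(1) and he = assms(2) and F = assms(3) and f = assms(4) and bdd = assms(5)
    and b = assms(6) and hom = assms(7) and D = assms(8)
  have inv: "homotopy_left_invertible X \<phi>"
    using he unfolding homotopy_equivalence_map_def homotopy_left_invertible_def by blast
  interpret lyapunov_pair X \<phi> f b
    using D inv by unfold_locales (auto simp: homotopy_left_invertible_def)
  let ?E = "esum (\<lambda>d. cat_in X (F \<inter> f -` {d})) {d. ereal d \<le> b}"
  let ?K = "f ` F \<inter> {d. ereal d \<le> b}"
  let ?G = "F \<inter> sublevel X f b"
  have a: "cat_in X (sublevel X f b) \<le> ?E"
    using cat_sublevel_le_esum[OF inv bdd b hom] unfolding F .
  have esum_finite: "?E = (\<Sum>d\<in>?K. cat_in X (F \<inter> f -` {d}))" if "finite ?K"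
    using that esum_cat_fixed_levels unfolding F by simp
  have FX: "F \<subseteq> topspace X" unfolding F fixed_points_def by blast
  have fG: "f ` ?G = ?K" using FX by (auto simp: sublevel_def)
  have Gd: "?G \<inter> f -` {d} = F \<inter> f -` {d}" if "d \<in> ?K" for d
    using that FX by (auto simp: sublevel_def)
  have part_b: "infinite ?G \<or> cat_in X (sublevel X f b) \<le> ecard ?K"
    if "connected_space X" "weakly_locally_contractible X"
  proof (cases "finite ?G")
    case fin: True
    then have finK: "finite ?K" unfolding fG[symmetric] by (rule finite_imageI)
    have "cat_in X (F \<inter> f -` {d}) \<le> 1" if "d \<in> ?K" for d
    proof (rule cat_in_finite_le_1[OF X \<open>connected_space X\<close> \<open>weakly_locally_contractible X\<close>])
      show "finite (F \<inter> f -` {d})" using fin Gd[OF that] by (metis finite_Int)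
    qed (use FX in blast)
    then have "?E \<le> (\<Sum>d\<in>?K. 1)" unfolding esum_finite[OF finK] by (rule sum_mono)
    also have "\<dots> = ecard ?K" using finK by (simp add: ecard_def of_nat_eq_enat)
    finally have "cat_in X (sublevel X f b) \<le> ecard ?K" using a by (rule order_trans[rotated])
    then show ?thesis ..
  qed simp
  have part_c: "cat_in X (sublevel X f b) \<le> cat_space (subtopology X ?G)"
    if small: "topspace X \<times> {0..1::real} \<lesssim> (UNIV :: 'u set)"
      and bin: "binormal_space X" and ANR: "ANR_space TYPE('u) X" and disc: "discrete (f ` F)"
  proof (cases "cat_space (subtopology X ?G) = \<infinity>")
    case False
    have "discrete (f ` ?G)"
      by (rule discrete_subset[OF disc]) blast
    note sum = sum_cat_space_fibres_le[OF f this False]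
    have GX: "?G \<subseteq> topspace X" using FX by blast
    have finK: "finite ?K" using sum(1)[OF GX] unfolding fG .
    have "closedin X F"
      unfolding F fixed_points_def using closedin_continuous_maps_eq[OF X cont_\<phi> continuous_map_id]
      by simp
    then have cl: "closedin X (F \<inter> f -` {d})" for d
    proof -
      have "closedin X {x \<in> topspace X. f x \<in> {d}}"
        by (rule closedin_continuous_map_preimage[OF f]) simp
      then have "closedin X (F \<inter> {x \<in> topspace X. f x \<in> {d}})"
        by (rule closedin_Int[OF \<open>closedin X F\<close>])
      moreover have "F \<inter> {x \<in> topspace X. f x \<in> {d}} = F \<inter> f -` {d}" using FX by auto
      ultimately show ?thesis by simp
    qed
    have "?E \<le> (\<Sum>d\<in>?K. cat_space (subtopology X (?G \<inter> f -` {d})))"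
      unfolding esum_finite[OF finK]
      by (rule sum_mono)
        (simp only: Gd cat_in_le_cat_space_closed_subspace[OF ANR small X bin cl])
    also have "\<dots> \<le> cat_space (subtopology X ?G)" using sum(2)[OF GX] unfolding fG .
    finally show ?thesis using a by (rule order_trans[rotated])
  qed simp
  show ?thesis using a part_b part_c by simp
qed

end
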